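(* Let $\mu\in\mathcal H$ with $\Re(\mu)=0$ and $m=N(\mu)$ squarefree. (i) If a primitive integral quaternion $\rho\in\mathcal H$ satisfies $\rho\mu=\mu'\rho$ for some $\mu'\in\mathcal H$, and $N(\rho)$ is odd whenever $m\equiv 3\pmod 8$, then $\rho$ is the right pseudo generator of some ideal of $\mathcal O(\mu)$ and the left pseudo generator of some ideal of $\mathcal O(\mu')$. (ii) Conversely, if $\rho$ is the right pseudo generator of an ideal $R_\mu(\rho)$ of $\mathcal O(\mu)$, then $\rho\mu=\mu'\rho$ for some $\mu'\in\mathcal H$, $N(\rho)$ is odd whenever $m\equiv 3\pmod 8$, and $L_{\mu'}(\rho)$ is an ideal of $\mathcal O(\mu')$ (with left pseudo generator $\rho$).
   Context: Quaternions with Hamilton multiplication, $\Re$, $N$, conjugate $\overline q$, $q^{-1}=\overline q/N(q)$. $\mathcal H$ = Hurwitz integral quaternions $(a+bi+cj+dk)/2$, $a,b,c,d\in\mathbb Z$ of equal parity. A quaternion $q\in\mathcal H$ is primitive if it is not of the form $nq_0$ with $n>1$ an integer and $q_0\in\mathcal H$. For $\nu\in\mathcal H$ with $\Re(\nu)=0$ and $N(\nu)=m$ squarefree, let $r=1$ if $m\not\equiv 3\pmod 4$, $r=2$ otherwise, $\omega_\nu=(r-1+\nu)/r$, and $\mathcal O(\nu)=\mathbb Z+\mathbb Z\omega_\nu$ (a commutative subring of $\mathcal H$). Every nonzero ideal of $\mathcal O(\nu)$ has a $\mathbb Z$-basis $c[a,b+\omega_\nu]$ with integers $c,a>0$, $b$;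 it is primitive if $c=1$. Its right (left) pseudo generator is $c\cdot\gcd_r(a,b+\omega_\nu)$ ($c\cdot\gcd_l(a,b+\omega_\nu)$), where $\gcd_r$ ($\gcd_l$) denotes a greatest-norm common right (left) divisor in $\mathcal H$, unique up to a unit on the left (right). $R_\nu(\rho)=\{\xi\rho:\xi\in\mathcal H,\ \xi\rho\in\mathcal O(\nu)\}$ and $L_\nu(\rho)=\{\rho\xi:\xi\in\mathcal H,\ \rho\xi\in\mathcal O(\nu)\}$ denote the ideals of $\mathcal O(\nu)$ with right, resp. left, pseudo generator $\rho$.
   Formalization: In (ii), the claim that N(ρ) is odd when m≡3 (mod 8) is stated for primitive ρ only; for non-primitive ρ it can fail (m=3, the ideal 2·O(μ) has pseudo generator 2 of norm 4). The other claims of (ii) are stated for all ρ. *)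

theory Defs
  imports Complex_Main "HOL-Computational_Algebra.Squarefree" "HOL-Algebra.Ideal"
begin

datatype quat = Quat (qRe: real) (qI: real) (qJ: real) (qK: real)

definition qnorm :: "quat \<Rightarrow> real" where
  "qnorm q = (qRe q)\<^sup>2 + (qI q)\<^sup>2 + (qJ q)\<^sup>2 + (qK q)\<^sup>2"

lemma qnorm_eq_0_iff: "qnorm q = 0 \<longleftrightarrow> q = Quat 0 0 0 0"
  by (cases q) (simp add: qnorm_def add_nonneg_eq_0_iff)

instantiation quat :: division_ring
begin

definition "0 = Quat 0 0 0 0"
definition "1 = Quat 1 0 0 0"
definition "p + q = Quat (qRe p + qRe q) (qI p + qI q) (qJ p + qJ q) (qK p + qK q)"
definition "- q = Quat (- qRe q) (- qI q) (- qJ q) (- qK q)"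
definition "p - q = Quat (qRe p - qRe q) (qI p - qI q) (qJ p - qJ q) (qK p - qK q)"
definition "p * q = Quat
   (qRe p * qRe q - qI p * qI q - qJ p * qJ q - qK p * qK q)
   (qRe p * qI q + qI p * qRe q + qJ p * qK q - qK p * qJ q)
   (qRe p * qJ q - qI p * qK q + qJ p * qRe q + qK p * qI q)
   (qRe p * qK q + qI p * qJ q - qJ p * qI q + qK p * qRe q)"

text \<open>Conjugate divided by norm.\<close>
definition "inverse q = Quat (qRe q / qnorm q) (- qI q / qnorm q) (- qJ q / qnorm q) (- qK q / qnorm q)"
definition "p div q = p * inverse q" for p q :: quat

lemmas quat_ring_defs =
  zero_quat_def one_quat_def plus_quat_def uminus_quat_def minus_quat_def times_quat_def

instance
proof
  fix a b c :: quat
  show "a * b * c = a * (b * c)" by (simp add: quat_ring_defs algebra_simps)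
  show "a + b + c = a + (b + c)" "a + b = b + a" "0 + a = a" "- a + a = 0" "a - b = a + - b"
    "1 * a = a" "a * 1 = a" "(0::quat) \<noteq> 1"
    by (simp_all add: quat_ring_defs quat.expand)
  show "(a + b) * c = a * c + b * c" "a * (b + c) = a * b + a * c"
    by (simp_all add: quat_ring_defs algebra_simps)
  show "inverse (0::quat) = 0" by (simp add: quat_ring_defs inverse_quat_def)
  show "a div b = a * inverse b" by (simp add: divide_quat_def)
  assume "a \<noteq> 0"
  then have "qnorm a \<noteq> 0" by (simp add: qnorm_eq_0_iff zero_quat_def)
  moreover have "qnorm a = qRe a * qRe a + qI a * qI a + qJ a * qJ a + qK a * qK a"
    by (simp add: qnorm_def power2_eq_square)
  ultimately show "inverse a * a = 1" "a * inverse a = 1"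
    by (simp_all add: quat_ring_defs inverse_quat_def add_divide_distrib [symmetric]
        diff_divide_distrib [symmetric] mult.commute)
qed

end

definition hurwitz :: "quat set" where
  "hurwitz = {Quat (of_int a / 2) (of_int b / 2) (of_int c / 2) (of_int d / 2) | a b c d :: int.
     (even a \<longleftrightarrow> even b) \<and> (even b \<longleftrightarrow> even c) \<and> (even c \<longleftrightarrow> even d)}"

definition primitive_quat :: "quat \<Rightarrow> bool" where
  "primitive_quat q \<longleftrightarrow> q \<in> hurwitz \<and> \<not> (\<exists>n::int. \<exists>q0\<in>hurwitz. n > 1 \<and> q = of_int n * q0)"

definition rdvd :: "quat \<Rightarrow> quat \<Rightarrow> bool" where
  "rdvd d x \<longleftrightarrow> (\<exists>q\<in>hurwitz. x = q * d)"

definition ldvd :: "quat \<Rightarrow> quat \<Rightarrow> bool" where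
  "ldvd d x \<longleftrightarrow> (\<exists>q\<in>hurwitz. x = d * q)"

text \<open>Greatest common one-sided divisors are only unique up to a unit, hence predicates.\<close>

definition is_gcd_r :: "quat \<Rightarrow> quat \<Rightarrow> quat \<Rightarrow> bool" where
  "is_gcd_r x y d \<longleftrightarrow> d \<in> hurwitz \<and> rdvd d x \<and> rdvd d y \<and>
     (\<forall>e\<in>hurwitz. rdvd e x \<and> rdvd e y \<longrightarrow> qnorm e \<le> qnorm d)"

definition is_gcd_l :: "quat \<Rightarrow> quat \<Rightarrow> quat \<Rightarrow> bool" where
  "is_gcd_l x y d \<longleftrightarrow> d \<in> hurwitz \<and> ldvd d x \<and> ldvd d y \<and>
     (\<forall>e\<in>hurwitz. ldvd e x \<and> ldvd e y \<longrightarrow> qnorm e \<le> qnorm d)"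

definition qord_r :: "quat \<Rightarrow> nat" where
  "qord_r \<nu> = (if \<exists>m::nat. qnorm \<nu> = of_nat m \<and> m mod 4 = 3 then 2 else 1)"

definition omega :: "quat \<Rightarrow> quat" where
  "omega \<nu> = (of_nat (qord_r \<nu>) - 1 + \<nu>) / of_nat (qord_r \<nu>)"

definition qord :: "quat \<Rightarrow> quat set" where
  "qord \<nu> = {of_int x + of_int y * omega \<nu> | x y :: int. True}"

definition qord_ring :: "quat \<Rightarrow> quat ring" where
  "qord_ring \<nu> = \<lparr>carrier = qord \<nu>, mult = (*), one = 1, zero = 0, add = (+)\<rparr>"

text \<open>The \<open>\<int>\<close>-span of \<open>c a\<close> and \<open>c (b + \<omega>)\<close>.\<close>
definition basis_span :: "quat \<Rightarrow> int \<Rightarrow> int \<Rightarrow> int \<Rightarrow> quat set" where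
  "basis_span \<nu> c a b =
     {of_int c * (of_int x * of_int a + of_int y * (of_int b + omega \<nu>)) | x y :: int. True}"

text \<open>\<open>I\<close> is an ideal and \<open>\<rho>\<close> is one of its pseudo generators. Since \<open>c, a > 0\<close>, such an \<open>I\<close> is nonzero.\<close>

definition right_pseudo_generator :: "quat \<Rightarrow> quat set \<Rightarrow> quat \<Rightarrow> bool" where
  "right_pseudo_generator \<nu> I \<rho> \<longleftrightarrow> ideal I (qord_ring \<nu>) \<and>
     (\<exists>c a b d. c > 0 \<and> a > 0 \<and> I = basis_span \<nu> c a b \<and>
        is_gcd_r (of_int a) (of_int b + omega \<nu>) d \<and> \<rho> = of_int c * d)"

definition left_pseudo_generator :: "quat \<Rightarrow> quat set \<Rightarrow> quat \<Rightarrow> bool" where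
  "left_pseudo_generator \<nu> I \<rho> \<longleftrightarrow> ideal I (qord_ring \<nu>) \<and>
     (\<exists>c a b d. c > 0 \<and> a > 0 \<and> I = basis_span \<nu> c a b \<and>
        is_gcd_l (of_int a) (of_int b + omega \<nu>) d \<and> \<rho> = of_int c * d)"

definition L_ideal :: "quat \<Rightarrow> quat \<Rightarrow> quat set" where
  "L_ideal \<nu> \<rho> = {\<rho> * \<xi> | \<xi>. \<xi> \<in> hurwitz \<and> \<rho> * \<xi> \<in> qord \<nu>}"

end

theory Submission
  imports Defs
begin

text \<open>
  If \<open>\<rho>\<close> conjugates \<open>\<mu>\<close> to \<open>\<mu>'\<close>, right multiplication by \<open>\<omega> = omega \<mu>\<close> acts on \<open>H / H\<rho>\<close>. For
  primitive \<open>\<rho>\<close> of norm \<open>n\<close> this action is by an integer scalar \<open>- b\<close>, so \<open>\<rho>\<close> divides \<open>b + \<omega>\<close>; it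
  is a greatest common divisor of \<open>n\<close> and \<open>b + \<omega>\<close>, since \<open>b + \<omega>\<close> is primitive and a primitive
  divisor of the integer \<open>n\<close> has norm dividing \<open>n\<close>. The scalar modulo the odd part of \<open>n\<close> comes from
  \<open>qcnj \<rho> * x * qcnj \<rho> = tr (x * qcnj \<rho>) * qcnj \<rho> - n * qcnj x\<close> with \<open>x\<close> such that the trace is \<open>1\<close>.
  The norm of a primitive quaternion is not divisible by \<open>4\<close>, and at the prime \<open>2\<close> it suffices to choose
  the parity of \<open>b\<close>. Left divisors are handled by conjugation. Conversely, since left ideals of \<open>H\<close> are
  principal, an ideal \<open>[a, b + \<omega>]\<close> generates \<open>H d\<close> with \<open>d\<close> the greatest common divisor, and
  closure under multiplication by \<open>\<omega>\<close> gives \<open>d * \<omega> \<in> H d\<close>.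
\<close>

section \<open>Coordinates, conjugation and the norm\<close>

lemma quat_eq_iff:
  "p = q \<longleftrightarrow> qRe p = qRe q \<and> qI p = qI q \<and> qJ p = qJ q \<and> qK p = qK q"
  by (cases p; cases q) simp

lemma quat_sel [simp]:
  "qRe 0 = 0" "qI 0 = 0" "qJ 0 = 0" "qK 0 = 0"
  "qRe 1 = 1" "qI 1 = 0" "qJ 1 = 0" "qK 1 = 0"
  "qRe (p + q) = qRe p + qRe q" "qI (p + q) = qI p + qI q"
  "qJ (p + q) = qJ p + qJ q" "qK (p + q) = qK p + qK q"
  "qRe (p - q) = qRe p - qRe q" "qI (p - q) = qI p - qI q"
  "qJ (p - q) = qJ p - qJ q" "qK (p - q) = qK p - qK q"
  "qRe (- q) = - qRe q" "qI (- q) = - qI q" "qJ (- q) = - qJ q" "qK (- q) = - qK q"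
  "qRe (p * q) = qRe p * qRe q - qI p * qI q - qJ p * qJ q - qK p * qK q"
  "qI (p * q) = qRe p * qI q + qI p * qRe q + qJ p * qK q - qK p * qJ q"
  "qJ (p * q) = qRe p * qJ q - qI p * qK q + qJ p * qRe q + qK p * qI q"
  "qK (p * q) = qRe p * qK q + qI p * qJ q - qJ p * qI q + qK p * qRe q"
  for p q :: quat
  by (simp_all add: quat_ring_defs)

lemma of_nat_quat: "of_nat n = Quat (of_nat n) 0 0 0"
  by (induction n) (simp_all add: quat_eq_iff)

lemma of_int_quat: "of_int z = Quat (of_int z) 0 0 0"
  by (cases z rule: int_cases2) (simp_all add: quat_eq_iff of_nat_quat)

lemma of_int_quat_sel [simp]:
  "qRe (of_int z) = of_int z" "qI (of_int z) = 0" "qJ (of_int z) = 0" "qK (of_int z) = 0"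
  by (simp_all add: of_int_quat)

lemma numeral_quat_sel [simp]:
  "qRe (numeral k) = numeral k" "qI (numeral k) = 0" "qJ (numeral k) = 0" "qK (numeral k) = 0"
  using of_int_quat_sel [of "numeral k"] by (simp_all only: of_int_numeral)

lemma of_int_quat_eq_0_iff [simp]: "(of_int z :: quat) = 0 \<longleftrightarrow> z = 0"
  by (simp add: quat_eq_iff)

definition qcnj :: "quat \<Rightarrow> quat" where
  "qcnj q = Quat (qRe q) (- qI q) (- qJ q) (- qK q)"

lemma qcnj_sel [simp]:
  "qRe (qcnj q) = qRe q" "qI (qcnj q) = - qI q" "qJ (qcnj q) = - qJ q" "qK (qcnj q) = - qK q"
  by (simp_all add: qcnj_def)

lemma qcnj_simps [simp]:
  "qcnj (qcnj q) = q" "qcnj (p + q) = qcnj p + qcnj q" "qcnj (p - q) = qcnj p - qcnj q"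
  "qcnj (- q) = - qcnj q" "qcnj (p * q) = qcnj q * qcnj p" "qcnj (of_int z) = of_int z"
  by (simp_all add: quat_eq_iff algebra_simps)

lemma qnorm_simps [simp]: "qnorm (qcnj q) = qnorm q" "qnorm (p * q) = qnorm p * qnorm q"
  "qnorm (of_int z) = (of_int z)\<^sup>2" "qnorm 0 = 0"
  by (simp_all add: qnorm_def power2_eq_square algebra_simps)

lemma qnorm_nonneg: "0 \<le> qnorm q"
  by (simp add: qnorm_def)

lemma qnorm_eq_0 [simp]: "qnorm q = 0 \<longleftrightarrow> q = 0"
  by (simp add: qnorm_eq_0_iff zero_quat_def)

lemma qcnj_mult:
  assumes "qnorm q = of_int n"
  shows "q * qcnj q = of_int n" "qcnj q * q = of_int n"
  using assms by (simp_all add: quat_eq_iff qnorm_def power2_eq_square algebra_simps)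

section \<open>The ring of Hurwitz quaternions\<close>

text \<open>These are the coordinates with respect to the basis \<open>(1 + i + j + k) / 2\<close>,
  \<open>i\<close>, \<open>j\<close>, \<open>k\<close>. They absorb the parity condition, so that
  closure properties become polynomial identities with explicit integer witnesses.\<close>

lemma hurwitz_iff_basis:
  "q \<in> hurwitz \<longleftrightarrow> (\<exists>e b c d :: int. qRe q = of_int e / 2 \<and> qI q = of_int e / 2 + of_int b \<and>
     qJ q = of_int e / 2 + of_int c \<and> qK q = of_int e / 2 + of_int d)"
proof
  assume "q \<in> hurwitz"
  then obtain A B C D :: int where q: "q = Quat (of_int A / 2) (of_int B / 2) (of_int C / 2) (of_int D / 2)"
    and "even A \<longleftrightarrow> even B" "even B \<longleftrightarrow> even C" "even C \<longleftrightarrow> even D"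
    by (auto simp: hurwitz_def)
  then have "even (B - A)" "even (C - A)" "even (D - A)"
    by auto
  then obtain b c d where "B - A = 2 * b" "C - A = 2 * c" "D - A = 2 * d"
    by (elim evenE)
  then have "B = A + 2 * b" "C = A + 2 * c" "D = A + 2 * d"
    by auto
  with q show "\<exists>e b c d :: int. qRe q = of_int e / 2 \<and> qI q = of_int e / 2 + of_int b \<and>
     qJ q = of_int e / 2 + of_int c \<and> qK q = of_int e / 2 + of_int d"
    by (intro exI [of _ A] exI [of _ b] exI [of _ c] exI [of _ d]) simp
next
  assume "\<exists>e b c d :: int. qRe q = of_int e / 2 \<and> qI q = of_int e / 2 + of_int b \<and>
     qJ q = of_int e / 2 + of_int c \<and> qK q = of_int e / 2 + of_int d"
  then obtain e b c d :: int where "qRe q = of_int e / 2" "qI q = of_int e / 2 + of_int b"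
     "qJ q = of_int e / 2 + of_int c" "qK q = of_int e / 2 + of_int d"
    by blast
  then have "q = Quat (of_int e / 2) (of_int (e + 2 * b) / 2) (of_int (e + 2 * c) / 2) (of_int (e + 2 * d) / 2)"
    by (simp add: quat_eq_iff)
  then show "q \<in> hurwitz"
    unfolding hurwitz_def by fastforce
qed

lemma hurwitzE:
  assumes "q \<in> hurwitz"
  obtains e b c d :: int where "qRe q = of_int e / 2" "qI q = of_int e / 2 + of_int b"
     "qJ q = of_int e / 2 + of_int c" "qK q = of_int e / 2 + of_int d"
  using assms unfolding hurwitz_iff_basis by blast

lemma hurwitzI:
  fixes e b c d :: int
  assumes "qRe q = of_int e / 2" "qI q = of_int e / 2 + of_int b"
     "qJ q = of_int e / 2 + of_int c" "qK q = of_int e / 2 + of_int d"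
  shows "q \<in> hurwitz"
  using assms unfolding hurwitz_iff_basis by blast

lemma hurwitz_of_int [simp]: "of_int z \<in> hurwitz"
  by (rule hurwitzI [of _ "2 * z" "-z" "-z" "-z"]) simp_all

lemma hurwitz_0 [simp]: "0 \<in> hurwitz" and hurwitz_1 [simp]: "1 \<in> hurwitz"
  using hurwitz_of_int [of 0] hurwitz_of_int [of 1] by simp_all

lemma hurwitz_add [simp]: assumes "p \<in> hurwitz" "q \<in> hurwitz" shows "p + q \<in> hurwitz"
proof -
  obtain e b c d :: int where p: "qRe p = of_int e / 2" "qI p = of_int e / 2 + of_int b"
     "qJ p = of_int e / 2 + of_int c" "qK p = of_int e / 2 + of_int d"
    using assms(1) by (rule hurwitzE)
  obtain e' b' c' d' :: int where q: "qRe q = of_int e' / 2" "qI q = of_int e' / 2 + of_int b'"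
     "qJ q = of_int e' / 2 + of_int c'" "qK q = of_int e' / 2 + of_int d'"
    using assms(2) by (rule hurwitzE)
  show ?thesis
    by (rule hurwitzI [of _ "e + e'" "b + b'" "c + c'" "d + d'"]) (simp_all add: p q)
qed

lemma hurwitz_mult [simp]: assumes "p \<in> hurwitz" "q \<in> hurwitz" shows "p * q \<in> hurwitz"
proof -
  obtain e b c d :: int where p: "qRe p = of_int e / 2" "qI p = of_int e / 2 + of_int b"
     "qJ p = of_int e / 2 + of_int c" "qK p = of_int e / 2 + of_int d"
    using assms(1) by (rule hurwitzE)
  obtain e' b' c' d' :: int where q: "qRe q = of_int e' / 2" "qI q = of_int e' / 2 + of_int b'"
     "qJ q = of_int e' / 2 + of_int c'" "qK q = of_int e' / 2 + of_int d'"
    using assms(2) by (rule hurwitzE)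
  show ?thesis
    \<comment> \<open>The first witness is twice the real part of the product; the other three are
      its imaginary coordinates minus the real part.\<close>
    by (rule hurwitzI [of _ "- (e * e' + e * (b' + c' + d') + e' * (b + c + d) + 2 * (b * b' + c * c' + d * d'))"
        "e * e' + e * (b' + d') + e' * (b + c) + b * b' + c * c' + d * d' + c * d' - d * c'"
        "e * e' + e * (c' + b') + e' * (c + d) + b * b' + c * c' + d * d' + d * b' - b * d'"
        "e * e' + e * (d' + c') + e' * (d + b) + b * b' + c * c' + d * d' + b * c' - c * b'"])
      (simp_all add: p q field_simps)
qed

lemma hurwitz_minus [simp]: "q \<in> hurwitz \<Longrightarrow> - q \<in> hurwitz"
  using hurwitz_mult [of "of_int (-1)" q] hurwitz_of_int [of "-1"] by simp

lemma hurwitz_diff [simp]: "p \<in> hurwitz \<Longrightarrow> q \<in> hurwitz \<Longrightarrow> p - q \<in> hurwitz"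
  using hurwitz_add [of p "- q"] by simp

lemma hurwitz_trace: assumes "q \<in> hurwitz" obtains t :: int where "2 * qRe q = of_int t"
  using assms by (auto elim!: hurwitzE)

lemma qcnj_eq_trace: "2 * qRe q = of_int t \<Longrightarrow> qcnj q = of_int t - q"
  by (auto simp: quat_eq_iff)

lemma hurwitz_qcnj [simp]: "qcnj q \<in> hurwitz \<longleftrightarrow> q \<in> hurwitz"
proof -
  have "qcnj p \<in> hurwitz" if "p \<in> hurwitz" for p
    using hurwitz_trace [OF that] qcnj_eq_trace that by (metis hurwitz_diff hurwitz_of_int)
  from this [of q] this [of "qcnj q"] show ?thesis
    by auto
qed

lemma hurwitz_qnorm:
  assumes "q \<in> hurwitz"
  obtains n :: int where "qnorm q = of_int n" "0 \<le> n"
proof -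
  obtain e b c d :: int where q: "qRe q = of_int e / 2" "qI q = of_int e / 2 + of_int b"
     "qJ q = of_int e / 2 + of_int c" "qK q = of_int e / 2 + of_int d"
    using assms by (rule hurwitzE)
  \<comment> \<open>Four copies of \<open>e * e / 4\<close> add up to an integer, so the norm is an
    integral quadratic form in the basis coordinates.\<close>
  have n: "qnorm q = of_int (e * e + e * (b + c + d) + b * b + c * c + d * d)"
    by (simp add: qnorm_def q power2_eq_square field_simps)
  then have "0 \<le> e * e + e * (b + c + d) + b * b + c * c + d * d"
    using qnorm_nonneg [of q] by linarith
  with n that show thesis
    by blast
qed

section \<open>One-sided divisibility and primitive quaternions\<close>

lemma of_int_mult_cancel_quat:
  fixes p q :: quat
  shows "of_int k * p = of_int k * q \<longleftrightarrow> k = 0 \<or> p = q"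
  by auto

lemma of_int_quat_commute: "q * of_int k = of_int k * (q :: quat)"
  by (simp add: mult_of_int_commute)

lemma of_int_quat_left_commute: "p * (of_int k * q) = of_int k * (p * q :: quat)"
  by (metis mult.assoc of_int_quat_commute)

lemma rdvd_qcnj: "rdvd (qcnj d) (qcnj x) \<longleftrightarrow> ldvd d x"
  unfolding rdvd_def ldvd_def
  by (metis qcnj_simps(1,5) hurwitz_qcnj)

lemma ldvd_qcnj: "ldvd (qcnj d) (qcnj x) \<longleftrightarrow> rdvd d x"
  using rdvd_qcnj [of "qcnj d" "qcnj x"] by simp

lemma primitive_qcnj: "primitive_quat (qcnj q) \<longleftrightarrow> primitive_quat q"
proof -
  have "primitive_quat (qcnj p)" if "primitive_quat p" for p
    unfolding primitive_quat_def
  proof (intro conjI notI)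
    show "qcnj p \<in> hurwitz"
      using that by (simp add: primitive_quat_def)
    assume "\<exists>n::int. \<exists>q0\<in>hurwitz. n > 1 \<and> qcnj p = of_int n * q0"
    then obtain n :: int and q0 where *: "q0 \<in> hurwitz" "n > 1" "qcnj p = of_int n * q0"
      by blast
    then have "p = qcnj (of_int n * q0)"
      by (metis qcnj_simps(1))
    then have "p = of_int n * qcnj q0"
      by (simp add: of_int_quat_commute)
    with * that show False
      unfolding primitive_quat_def by (metis hurwitz_qcnj)
  qed
  from this [of q] this [of "qcnj q"] show ?thesis
    by auto
qed

lemma primitive_quat_nonzero: "primitive_quat q \<Longrightarrow> q \<noteq> 0"
  unfolding primitive_quat_def
  by (metis hurwitz_0 mult_zero_right one_less_numeral_iff semiring_norm(76))

lemma primitive_ldvd_of_int: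
  assumes "primitive_quat q" "ldvd (of_int k) q" "k > 0"
  shows "k = 1"
  using assms unfolding primitive_quat_def ldvd_def by force

text \<open>Euclid's lemma for integer divisors: a relation \<open>u * k + v * l = 1\<close> writes
  \<open>q\<close> as a sum of two multiples of \<open>k\<close>, because integers are
  central.\<close>

lemma ldvd_of_int_coprime:
  assumes "ldvd (of_int k) (of_int l * q)" "coprime k l" "q \<in> hurwitz"
  shows "ldvd (of_int k) q"
proof -
  obtain h where h: "h \<in> hurwitz" "of_int l * q = of_int k * h"
    using assms(1) by (auto simp: ldvd_def)
  obtain u v where "u * k + v * l = 1"
    using bezout_int [of k l] assms(2) by auto
  then have "q = of_int (u * k + v * l) * q"
    by simp
  also have "\<dots> = of_int k * (of_int u * q) + of_int v * (of_int l * q)"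
    by (simp add: distrib_right mult.assoc of_int_quat_left_commute [of "of_int u" k])
  also have "\<dots> = of_int k * (of_int u * q + of_int v * h)"
    by (simp add: h distrib_left of_int_quat_left_commute [of "of_int v" k])
  finally show ?thesis
    using h assms(3) unfolding ldvd_def by (metis hurwitz_add hurwitz_mult hurwitz_of_int)
qed

text \<open>Multiplying \<open>z = q * h\<close> by the conjugate gives
  \<open>z * qcnj q = n * h\<close>. After cancelling \<open>gcd n z\<close>, the remaining factor
  \<open>n'\<close> of \<open>n\<close> is coprime to \<open>z'\<close> and divides the primitive
  quaternion \<open>qcnj q\<close>, so it is \<open>1\<close>.\<close>

lemma primitive_ldvd_int:
  assumes "primitive_quat q" "qnorm q = of_int n" "ldvd q (of_int z)"
  shows "n dvd z"
proof -
  from assms(3) obtain h where h: "h \<in> hurwitz" "of_int z = q * h"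
    by (auto simp: ldvd_def)
  have q: "q \<in> hurwitz" "q \<noteq> 0"
    using assms(1) primitive_quat_nonzero by (auto simp: primitive_quat_def)
  then have n: "n > 0"
    using qnorm_nonneg [of q] assms(2) by (metis less_eq_real_def of_int_0_less_iff qnorm_eq_0)
  define g where "g = gcd n z"
  have g: "g > 0"
    using n by (simp add: g_def)
  obtain n' z' where nz: "n = g * n'" "z = g * z'" "coprime n' z'"
    using gcd_coprime_exists [of n z] n unfolding g_def by (metis gcd_eq_0_iff less_irrefl mult.commute)
  have "of_int z * qcnj q = qcnj q * (q * h)"
    by (simp add: h(2) [symmetric] of_int_quat_commute)
  also have "\<dots> = of_int n * h"
    using qcnj_mult(2) [OF assms(2)] by (simp add: mult.assoc [symmetric])
  finally have "of_int g * (of_int z' * qcnj q) = of_int g * (of_int n' * h)"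
    by (simp add: nz mult.assoc)
  then have "of_int z' * qcnj q = of_int n' * h"
    using g by (auto simp only: of_int_mult_cancel_quat)
  then have "ldvd (of_int n') (of_int z' * qcnj q)"
    using h by (auto simp: ldvd_def)
  then have "ldvd (of_int n') (qcnj q)"
    using ldvd_of_int_coprime nz(3) q(1) by auto
  moreover have "n' > 0"
    using n g nz(1) by (simp add: zero_less_mult_iff)
  ultimately have "n' = 1"
    using primitive_ldvd_of_int assms(1) primitive_qcnj by blast
  then show ?thesis
    using nz by simp
qed

text \<open>An integer factor of \<open>d\<close> is central and could be pulled out of the product
  \<open>p * d\<close>.\<close>

lemma primitive_divisor:
  assumes "primitive_quat x" "x = p * d" "p \<in> hurwitz" "d \<in> hurwitz"
  shows "primitive_quat d"
  unfolding primitive_quat_def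
proof (intro conjI notI)
  assume "\<exists>n::int. \<exists>q0\<in>hurwitz. n > 1 \<and> d = of_int n * q0"
  then obtain n :: int and q0 where *: "q0 \<in> hurwitz" "n > 1" "d = of_int n * q0"
    by blast
  then have "x = of_int n * (p * q0)"
    using assms(2) by (simp add: of_int_quat_left_commute)
  with * assms show False
    unfolding primitive_quat_def by (metis hurwitz_mult)
qed (fact assms)

text \<open>The idea is \<open>x * qcnj q = t - q * qcnj x\<close>, where \<open>t\<close> is the trace.\<close>
lemma qcnj_sandwich:
  assumes "2 * qRe (x * qcnj q) = of_int t" "qnorm q = of_int n"
  shows "qcnj q * x * qcnj q = of_int t * qcnj q - of_int n * qcnj x"
proof -
  have "x * qcnj q = of_int t - q * qcnj x"
    using qcnj_eq_trace [OF assms(1)] by (simp add: algebra_simps)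
  then have "qcnj q * (x * qcnj q) = of_int t * qcnj q - (qcnj q * q) * qcnj x"
    by (simp add: right_diff_distrib mult.assoc of_int_quat_commute)
  then show ?thesis
    by (simp add: mult.assoc [symmetric] qcnj_mult(2) [OF assms(2)])
qed

section \<open>Primitive quaternions modulo odd integers and modulo 2\<close>

text \<open>For \<open>x\<close> with integer coordinates the trace of \<open>x * qcnj q\<close> is
  an integer combination of the doubled coordinates of \<open>q\<close>. Together with
  \<open>n\<close> these have greatest common divisor \<open>1\<close>, so a Bezout relation
  provides \<open>x\<close>.\<close>

lemma primitive_trace_eq_1_mod_odd:
  assumes "primitive_quat q" "odd n"
  shows "\<exists>x\<in>hurwitz. \<exists>v. 2 * qRe (x * qcnj q) = of_int (1 - n * v)"
proof -
  from assms(1) obtain A B C D :: int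
    where q: "q = Quat (of_int A / 2) (of_int B / 2) (of_int C / 2) (of_int D / 2)"
    and par: "even A \<longleftrightarrow> even B" "even B \<longleftrightarrow> even C" "even C \<longleftrightarrow> even D"
    by (auto simp: hurwitz_def primitive_quat_def)
  define g where "g = gcd A (gcd B (gcd C (gcd D n)))"
  have dvd: "g dvd A" "g dvd B" "g dvd C" "g dvd D" "g dvd n"
    unfolding g_def by (meson dvd_refl dvd_gcdD1 dvd_gcdD2)+
  then have "odd g" "g \<noteq> 0"
    using assms(2) dvd_trans by auto
  then have "g > 0"
    unfolding g_def using gcd_ge_0_int by (metis order_less_le)
  obtain A' B' C' D' where ABCD: "A = g * A'" "B = g * B'" "C = g * C'" "D = g * D'"
    using dvd by (elim dvdE)
  \<comment> \<open>Division by the odd number \<open>g\<close> preserves parities, so the quotient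
    is again a Hurwitz quaternion. This is where oddness of \<open>n\<close> enters.\<close>
  have "Quat (of_int A' / 2) (of_int B' / 2) (of_int C' / 2) (of_int D' / 2) \<in> hurwitz"
    using par \<open>odd g\<close> unfolding hurwitz_def ABCD by auto
  moreover have "q = of_int g * Quat (of_int A' / 2) (of_int B' / 2) (of_int C' / 2) (of_int D' / 2)"
    by (simp add: q ABCD quat_eq_iff)
  ultimately have "g = 1"
    using primitive_ldvd_of_int [OF assms(1)] \<open>g > 0\<close> unfolding ldvd_def by blast
  obtain u1 w1 where 1: "u1 * A + w1 * gcd B (gcd C (gcd D n)) = 1"
    using bezout_int \<open>g = 1\<close> unfolding g_def by metis
  obtain u2 w2 where 2: "u2 * B + w2 * gcd C (gcd D n) = gcd B (gcd C (gcd D n))"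
    using bezout_int by metis
  obtain u3 w3 where 3: "u3 * C + w3 * gcd D n = gcd C (gcd D n)"
    using bezout_int by metis
  obtain u4 w4 where 4: "u4 * D + w4 * n = gcd D n"
    using bezout_int by metis
  define a b c d where "a = u1" and "b = w1 * u2" and "c = w1 * w2 * u3" and "d = w1 * w2 * w3 * u4"
  have "a * A + b * B + c * C + d * D = 1 - n * (w1 * w2 * w3 * w4)"
  proof -
    have "u1 * A + w1 * (u2 * B + w2 * (u3 * C + w3 * (u4 * D + w4 * n))) = 1"
      using 1 2 3 4 by simp
    then show ?thesis
      by (simp add: a_def b_def c_def d_def algebra_simps)
  qed
  moreover define x where "x = Quat (of_int a) (of_int b) (of_int c) (of_int d)"
  moreover have "2 * qRe (x * qcnj q) = of_int (a * A + b * B + c * C + d * D)"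
    by (simp add: x_def q field_simps)
  moreover have "x \<in> hurwitz"
    by (rule hurwitzI [of _ "2 * a" "b - a" "c - a" "d - a"]) (simp_all add: x_def)
  ultimately show ?thesis
    by metis
qed

lemma odd_square_mod_8: "odd x \<Longrightarrow> x\<^sup>2 mod 8 = (1::int)"
proof -
  assume "odd x"
  then obtain k where k: "x = 2 * k + 1" by (rule oddE)
  have "even (k * (k + 1))" by simp
  then obtain l where "k * (k + 1) = 2 * l" by (rule evenE)
  then have "x\<^sup>2 = 8 * l + 1"
    by (simp add: k power2_eq_square algebra_simps)
  then show ?thesis by simp
qed

lemma square_mod_4: "x\<^sup>2 mod 4 = (if even x then 0 else 1 :: int)"
proof (cases "even x")
  case True
  then show ?thesis
    by (auto simp: power2_eq_square elim!: evenE)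
next
  case False
  have "x\<^sup>2 mod 4 = x\<^sup>2 mod 8 mod 4"
    by (simp add: mod_mod_cancel)
  with False show ?thesis
    by (simp add: odd_square_mod_8)
qed

text \<open>Four odd squares sum to \<open>4\<close> modulo \<open>8\<close>, whereas for even norm
  the squares of the doubled coordinates sum to a multiple of \<open>8\<close>. Hence half-odd
  coordinates are impossible.\<close>

lemma hurwitz_even_norm_coords:
  assumes "q \<in> hurwitz" "qnorm q = of_int (2 * n)"
  obtains a b c d :: int where "q = Quat (of_int a) (of_int b) (of_int c) (of_int d)"
    "even (a + b + c + d)" "a\<^sup>2 + b\<^sup>2 + c\<^sup>2 + d\<^sup>2 = 2 * n"
proof -
  from assms(1) obtain A B C D :: int
    where q: "q = Quat (of_int A / 2) (of_int B / 2) (of_int C / 2) (of_int D / 2)"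
    and par: "even A \<longleftrightarrow> even B" "even B \<longleftrightarrow> even C" "even C \<longleftrightarrow> even D"
    by (auto simp: hurwitz_def)
  have "(of_int (A\<^sup>2 + B\<^sup>2 + C\<^sup>2 + D\<^sup>2) :: real) = of_int (8 * n)"
    using assms(2) by (simp add: q qnorm_def power_divide)
  then have N: "A\<^sup>2 + B\<^sup>2 + C\<^sup>2 + D\<^sup>2 = 8 * n"
    by (simp only: of_int_eq_iff)
  have "even A"
  proof (rule ccontr)
    assume "odd A"
    then have "A\<^sup>2 mod 8 = 1" "B\<^sup>2 mod 8 = 1" "C\<^sup>2 mod 8 = 1" "D\<^sup>2 mod 8 = 1"
      using par by (simp_all add: odd_square_mod_8)
    with N show False by presburger
  qed
  then have "even A" "even B" "even C" "even D"
    using par by auto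
  then obtain a b c d where abcd: "A = 2 * a" "B = 2 * b" "C = 2 * c" "D = 2 * d"
    by (elim evenE)
  have S: "a\<^sup>2 + b\<^sup>2 + c\<^sup>2 + d\<^sup>2 = 2 * n"
    using N by (simp add: abcd power_mult_distrib)
  then have "even (a\<^sup>2 + b\<^sup>2 + c\<^sup>2 + d\<^sup>2)"
    by simp
  then have "even (a + b + c + d)"
    by simp
  with S show thesis
    by (intro that [of a b c d]) (simp_all add: q abcd)
qed

lemma ldvd_2_integer_coords:
  fixes a b c d :: int
  assumes "even a \<longleftrightarrow> even b" "even b \<longleftrightarrow> even c" "even c \<longleftrightarrow> even d"
  shows "ldvd (of_int 2) (Quat (of_int a) (of_int b) (of_int c) (of_int d))"
  unfolding ldvd_def
proof
  show "Quat (of_int a / 2) (of_int b / 2) (of_int c / 2) (of_int d / 2) \<in> hurwitz"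
    using assms unfolding hurwitz_def by auto
  show "Quat (of_int a) (of_int b) (of_int c) (of_int d) =
      of_int 2 * Quat (of_int a / 2) (of_int b / 2) (of_int c / 2) (of_int d / 2)"
    by (simp add: quat_eq_iff)
qed

text \<open>The quaternions of even norm form the two-sided ideal generated by \<open>1 + i\<close>, and
  \<open>(1 + i)\<^sup>2 = 2 * i\<close>.\<close>
lemma ldvd_2_mult_even_norm:
  assumes "p \<in> hurwitz" "qnorm p = of_int (2 * k)" "q \<in> hurwitz" "qnorm q = of_int (2 * l)"
  shows "ldvd (of_int 2) (p * q)"
proof -
  obtain a b c d :: int where p: "p = Quat (of_int a) (of_int b) (of_int c) (of_int d)"
    "even (a + b + c + d)"
    using assms(1,2) by (rule hurwitz_even_norm_coords)
  obtain a' b' c' d' :: int where q: "q = Quat (of_int a') (of_int b') (of_int c') (of_int d')"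
    "even (a' + b' + c' + d')"
    using assms(3,4) by (rule hurwitz_even_norm_coords)
  have "p * q = Quat (of_int (a * a' - b * b' - c * c' - d * d')) (of_int (a * b' + b * a' + c * d' - d * c'))
     (of_int (a * c' - b * d' + c * a' + d * b')) (of_int (a * d' + b * c' - c * b' + d * a'))"
    by (simp add: p q quat_eq_iff)
  \<comment> \<open>All four coordinates have the same parity. For instance, modulo 2 the first two
    add up to \<open>(a + b) * (a' + b') + (c + d) * (c' + d')\<close>, and both products have the
    same parity since the coordinate sums of \<open>p\<close> and \<open>q\<close> are even.\<close>
  moreover have "ldvd (of_int 2) \<dots>"
    by (rule ldvd_2_integer_coords; use p(2) q(2) in simp; blast)
  ultimately show ?thesis
    by simp
qed

text \<open>If \<open>4\<close> divides the norm, the coordinates are integers; four squares sum to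
  \<open>0\<close> modulo \<open>4\<close> only if all are even or all are odd, and then
  \<open>2\<close> divides \<open>q\<close>.\<close>

lemma primitive_not_4_dvd_norm:
  assumes "primitive_quat q" "qnorm q = of_int n"
  shows "\<not> 4 dvd n"
proof
  assume "4 dvd n"
  then obtain k where k: "n = 4 * k" ..
  obtain a b c d :: int where q: "q = Quat (of_int a) (of_int b) (of_int c) (of_int d)"
    "even (a + b + c + d)" "a\<^sup>2 + b\<^sup>2 + c\<^sup>2 + d\<^sup>2 = 2 * (2 * k)"
  proof (rule hurwitz_even_norm_coords)
    show "q \<in> hurwitz" "qnorm q = of_int (2 * (2 * k))"
      using assms by (simp_all add: k primitive_quat_def)
  qed
  have "(((a\<^sup>2 mod 4 + b\<^sup>2 mod 4) mod 4 + c\<^sup>2 mod 4) mod 4 + d\<^sup>2 mod 4) mod 4 = (2 * (2 * k)) mod 4"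
    unfolding q(3) [symmetric] by (simp only: mod_simps)
  then have "(even a \<longleftrightarrow> even b) \<and> (even b \<longleftrightarrow> even c) \<and> (even c \<longleftrightarrow> even d)"
    by (simp add: square_mod_4 split: if_splits)
  then have "ldvd (of_int 2) q"
    unfolding q(1) by (intro ldvd_2_integer_coords) auto
  then show False
    using primitive_ldvd_of_int [OF assms(1)] by fastforce
qed


section \<open>The generator \<open>omega\<close> and its order\<close>

text \<open>The standing hypotheses, bundled with the norm \<open>m\<close> so that they can be
  transferred from \<mu> to its conjugate \<mu>', which then has the same
  \<open>qord_r\<close>.\<close>

definition pure_sqfree :: "quat \<Rightarrow> nat \<Rightarrow> bool" where
  "pure_sqfree \<nu> m \<longleftrightarrow> \<nu> \<in> hurwitz \<and> qRe \<nu> = 0 \<and> qnorm \<nu> = of_nat m \<and> squarefree m"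

lemma qord_r_eq: "qnorm \<nu> = of_nat m \<Longrightarrow> qord_r \<nu> = (if m mod 4 = 3 then 2 else 1)"
  by (auto simp: qord_r_def)

lemma omega_eq:
  assumes "qnorm \<nu> = of_nat m"
  shows "omega \<nu> = (if m mod 4 = 3
    then Quat (1 / 2 + qRe \<nu> / 2) (qI \<nu> / 2) (qJ \<nu> / 2) (qK \<nu> / 2) else \<nu>)"
proof (cases "m mod 4 = 3")
  case True
  have inv: "inverse 2 = Quat (1 / 2) 0 0 0"
    unfolding inverse_quat_def by (simp add: qnorm_def)
  have "omega \<nu> = (2 - 1 + \<nu>) / 2"
    using True by (simp add: omega_def qord_r_eq [OF assms])
  also have "\<dots> = (2 - 1 + \<nu>) * Quat (1 / 2) 0 0 0"
    unfolding divide_quat_def inv ..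
  finally have "omega \<nu> = (2 - 1 + \<nu>) * Quat (1 / 2) 0 0 0" .
  with True show ?thesis
    by (simp add: quat_eq_iff add_divide_distrib)
qed (simp add: omega_def qord_r_eq [OF assms])

text \<open>A vanishing real part forces integer coordinates, and a common divisor \<open>g\<close>
  of them would satisfy \<open>g\<^sup>2 dvd m\<close>. Three squares sum to \<open>3\<close> modulo
  \<open>4\<close> only if all are odd, and then the sum is \<open>3\<close> modulo
  \<open>8\<close>; this reconciles the condition modulo \<open>8\<close> with the one modulo
  \<open>4\<close> in \<open>qord_r\<close>.\<close>

lemma pure_sqfree_coords:
  assumes "pure_sqfree \<nu> m"
  obtains x y z u v w :: int where "\<nu> = Quat 0 (of_int x) (of_int y) (of_int z)"
    "x\<^sup>2 + y\<^sup>2 + z\<^sup>2 = int m" "u * x + v * y + w * z = 1"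
    "m mod 4 = 3 \<longleftrightarrow> odd x \<and> odd y \<and> odd z" "m mod 8 = 3 \<longleftrightarrow> m mod 4 = 3"
proof -
  obtain e b c d :: int where q: "qRe \<nu> = of_int e / 2" "qI \<nu> = of_int e / 2 + of_int b"
     "qJ \<nu> = of_int e / 2 + of_int c" "qK \<nu> = of_int e / 2 + of_int d"
    using assms hurwitzE unfolding pure_sqfree_def by blast
  have "e = 0"
    using q(1) assms by (simp add: pure_sqfree_def)
  then have \<nu>: "\<nu> = Quat 0 (of_int b) (of_int c) (of_int d)"
    using q by (simp add: quat_eq_iff)
  then have "(of_int (b\<^sup>2 + c\<^sup>2 + d\<^sup>2) :: real) = of_int (int m)"
    using assms by (simp add: pure_sqfree_def qnorm_def)
  then have N: "b\<^sup>2 + c\<^sup>2 + d\<^sup>2 = int m"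
    by (simp only: of_int_eq_iff)
  define g where "g = gcd b (gcd c d)"
  have "g dvd b" "g dvd c" "g dvd d"
    unfolding g_def by (meson dvd_refl dvd_gcdD1 dvd_gcdD2)+
  then have "g\<^sup>2 dvd int m"
    unfolding N [symmetric] by (intro dvd_add dvd_power_same)
  moreover have "g \<ge> 0"
    by (simp add: g_def)
  ultimately have "(nat g)\<^sup>2 dvd m"
    by (metis int_dvd_int_iff int_nat_eq of_nat_power)
  then have "nat g dvd 1"
    using assms by (simp add: pure_sqfree_def squarefree_def)
  then have "g = 1"
    using \<open>g \<ge> 0\<close> by simp
  obtain u1 w1 where 1: "u1 * b + w1 * gcd c d = 1"
    using bezout_int \<open>g = 1\<close> unfolding g_def by metis
  obtain u2 w2 where 2: "u2 * c + w2 * d = gcd c d"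
    using bezout_int by metis
  have B: "u1 * b + (w1 * u2) * c + (w1 * w2) * d = 1"
    using 1 2 [symmetric] by (simp add: algebra_simps)
  have "((b\<^sup>2 mod 4 + c\<^sup>2 mod 4) mod 4 + d\<^sup>2 mod 4) mod 4 = int (m mod 4)"
    by (simp only: mod_simps N zmod_int of_nat_numeral)
  then have m4: "m mod 4 = 3 \<longleftrightarrow> odd b \<and> odd c \<and> odd d"
    by (simp add: square_mod_4 split: if_splits)
  have m8: "m mod 8 = 3 \<longleftrightarrow> m mod 4 = 3"
  proof
    assume "m mod 4 = 3"
    then have "b\<^sup>2 mod 8 = 1" "c\<^sup>2 mod 8 = 1" "d\<^sup>2 mod 8 = 1"
      using m4 by (simp_all add: odd_square_mod_8)
    with N show "m mod 8 = 3"
      by presburger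
  qed presburger
  show thesis
    by (rule that [OF \<nu> N B m4 m8])
qed

text \<open>The norm is multiplicative, and the real part is invariant because multiplying the
  relation by \<open>qcnj \<rho>\<close> on the right scales both real parts by
  \<open>qnorm \<rho>\<close>.\<close>

lemma pure_sqfree_conjugate:
  assumes "pure_sqfree \<nu> m" "\<nu>' \<in> hurwitz" "\<rho> * \<nu> = \<nu>' * \<rho>" "\<rho> \<noteq> 0"
  shows "pure_sqfree \<nu>' m"
proof -
  have n: "qnorm \<rho> \<noteq> 0"
    using assms(4) by simp
  have "qnorm \<rho> * qnorm \<nu> = qnorm \<nu>' * qnorm \<rho>"
    using assms(3) by (metis qnorm_simps(2))
  then have "qnorm \<nu>' = qnorm \<nu>"
    using n by simp
  moreover have "qRe (\<rho> * \<nu> * qcnj \<rho>) = qnorm \<rho> * qRe \<nu>" "qRe (\<nu>' * \<rho> * qcnj \<rho>) = qnorm \<rho> * qRe \<nu>'"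
    by (simp_all add: qnorm_def power2_eq_square algebra_simps)
  then have "qRe \<nu>' = qRe \<nu>"
    using n assms(3) by simp
  ultimately show ?thesis
    using assms by (simp add: pure_sqfree_def)
qed

lemma omega_scaled:
  assumes "pure_sqfree \<nu> m"
  shows "of_int (int (qord_r \<nu>)) * omega \<nu> = of_int (int (qord_r \<nu>) - 1) + \<nu>"
  using assms by (simp add: pure_sqfree_def quat_eq_iff omega_eq qord_r_eq)

lemma qord_r_nonzero [simp]: "qord_r \<nu> \<noteq> 0"
  by (simp add: qord_r_def)

text \<open>Multiplied by \<open>qord_r \<nu>\<close>, \<open>omega \<nu>\<close> is \<nu> plus an
  integer, so it inherits the relation; the central factor then cancels.\<close>

lemma omega_conjugate:
  assumes "pure_sqfree \<nu> m" "pure_sqfree \<nu>' m" "\<rho> * \<nu> = \<nu>' * \<rho>"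
  shows "\<rho> * omega \<nu> = omega \<nu>' * \<rho>"
proof -
  have r: "qord_r \<nu>' = qord_r \<nu>"
    using assms by (simp add: pure_sqfree_def qord_r_eq)
  have "of_int (int (qord_r \<nu>)) * (\<rho> * omega \<nu>) = \<rho> * (of_int (int (qord_r \<nu>)) * omega \<nu>)"
    by (rule of_int_quat_left_commute [symmetric])
  also have "\<dots> = (of_int (int (qord_r \<nu>)) * omega \<nu>') * \<rho>"
    unfolding omega_scaled [OF assms(1)] omega_scaled [OF assms(2), unfolded r]
    by (simp only: distrib_left distrib_right assms(3) of_int_quat_commute)
  finally have "of_int (int (qord_r \<nu>)) * (\<rho> * omega \<nu>) = of_int (int (qord_r \<nu>)) * (omega \<nu>' * \<rho>)"
    by (simp only: mult.assoc)
  then show ?thesis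
    by (simp only: of_int_mult_cancel_quat) simp
qed

lemma omega_hurwitz:
  assumes "pure_sqfree \<nu> m"
  shows "omega \<nu> \<in> hurwitz"
proof -
  obtain x y z u v w :: int where *: "\<nu> = Quat 0 (of_int x) (of_int y) (of_int z)"
    "m mod 4 = 3 \<longleftrightarrow> odd x \<and> odd y \<and> odd z"
    using pure_sqfree_coords [OF assms] by metis
  have n: "qnorm \<nu> = of_nat m"
    using assms by (simp add: pure_sqfree_def)
  show ?thesis
  proof (cases "m mod 4 = 3")
    case True
    then have "omega \<nu> = Quat (of_int 1 / 2) (of_int x / 2) (of_int y / 2) (of_int z / 2)"
      by (simp add: omega_eq [OF n]) (simp add: *)
    moreover have "odd x" "odd y" "odd z"
      using True * by auto
    ultimately show ?thesis
      unfolding hurwitz_def 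
      by (intro CollectI exI [of _ 1] exI [of _ x] exI [of _ y] exI [of _ z]) simp
  next
    case False
    then show ?thesis
      using assms by (simp add: omega_eq [OF n] pure_sqfree_def)
  qed
qed

lemma omega_trace:
  assumes "pure_sqfree \<nu> m"
  shows "2 * qRe (omega \<nu>) = of_int (int (qord_r \<nu>) - 1)"
  using assms by (simp add: pure_sqfree_def omega_eq qord_r_eq)

text \<open>The order is optimally embedded: its intersection with \<open>c * hurwitz\<close> is
  \<open>c\<close> times the order. The coprime imaginary coordinates of \<nu> isolate
  \<open>y\<close>, and the parity condition on Hurwitz quaternions then gives
  \<open>x\<close>.\<close>

lemma qord_ldvd_of_int:
  assumes "pure_sqfree \<nu> m" "c > 0" "ldvd (of_int c) (of_int x + of_int y * omega \<nu>)"
  shows "c dvd x \<and> c dvd y"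
proof -
  obtain a1 a2 a3 u v w :: int where \<nu>: "\<nu> = Quat 0 (of_int a1) (of_int a2) (of_int a3)"
    and bez: "u * a1 + v * a2 + w * a3 = 1"
    and m4: "m mod 4 = 3 \<longleftrightarrow> odd a1 \<and> odd a2 \<and> odd a3"
    using pure_sqfree_coords [OF assms(1)] by metis
  have n: "qnorm \<nu> = of_nat m"
    using assms by (simp add: pure_sqfree_def)
  from assms(3) obtain E E1 E2 E3 :: int where
    eq: "of_int x + of_int y * omega \<nu> =
      of_int c * Quat (of_int E / 2) (of_int E1 / 2) (of_int E2 / 2) (of_int E3 / 2)"
    and par: "even E \<longleftrightarrow> even E1" "even E1 \<longleftrightarrow> even E2" "even E2 \<longleftrightarrow> even E3"
    unfolding ldvd_def hurwitz_def by blast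
  have sel: "qRe \<nu> = 0" "qI \<nu> = of_int a1" "qJ \<nu> = of_int a2" "qK \<nu> = of_int a3"
    by (simp_all add: \<nu>)
  \<comment> \<open>The Bezout combination of the doubled imaginary coordinates of the quotient;
    \<open>c * Y\<close> is \<open>y\<close> if \<open>m mod 4 = 3\<close>, and \<open>2 * y\<close>
    otherwise.\<close>
  define Y where "Y = u * E1 + v * E2 + w * E3"
  have lift: "a = b" if "(of_int a :: real) = of_int b" for a b
    using that by simp
  show ?thesis
  proof (cases "m mod 4 = 3")
    case True
    have "2 * x + y = c * E" "y * a1 = c * E1" "y * a2 = c * E2" "y * a3 = c * E3"
      using eq by (auto simp: quat_eq_iff omega_eq [OF n] True sel field_simps intro!: lift)
    moreover have "y = u * (y * a1) + v * (y * a2) + w * (y * a3)"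
    proof -
      have "y = y * (u * a1 + v * a2 + w * a3)" by (simp add: bez)
      then show ?thesis by (simp add: algebra_simps)
    qed
    ultimately have y: "y = c * Y" and x: "2 * x + c * Y = c * E"
      by (simp_all add: Y_def algebra_simps)
    have "c * (Y * a1) = c * E1"
      using \<open>y * a1 = c * E1\<close> y by (simp add: mult.assoc)
    then have "E1 = Y * a1"
      using assms(2) by simp
    \<comment> \<open>Here \<open>a1\<close> is odd, so \<open>Y\<close> has the parity of
      \<open>E1\<close> and hence of \<open>E\<close>.\<close>
    then have "even (E - Y)"
      using par m4 True by auto
    then obtain k where "E - Y = 2 * k" by (rule evenE)
    then have "E = 2 * k + Y" by simp
    then have "x = c * k"
      using x by (simp add: algebra_simps)
    with y show ?thesis by simp
  next
    case False
    have 1: "2 * x = c * E" "2 * y * a1 = c * E1" "2 * y * a2 = c * E2" "2 * y * a3 = c * E3"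
      using eq by (auto simp: quat_eq_iff omega_eq [OF n] False sel field_simps intro!: lift)
    have "2 * y = u * (2 * y * a1) + v * (2 * y * a2) + w * (2 * y * a3)"
    proof -
      have "2 * y = 2 * y * (u * a1 + v * a2 + w * a3)" by (simp add: bez)
      then show ?thesis by (simp add: algebra_simps)
    qed
    then have y: "2 * y = c * Y"
      unfolding 1 by (simp add: Y_def algebra_simps)
    have "c * (Y * a1) = c * E1" "c * (Y * a2) = c * E2" "c * (Y * a3) = c * E3"
      using 1 y by (simp_all add: mult.assoc)
    then have "E1 = Y * a1" "E2 = Y * a2" "E3 = Y * a3"
      using assms(2) by simp_all
    \<comment> \<open>Some \<open>a1\<close>, \<open>a2\<close>, \<open>a3\<close> is even, which
      makes the corresponding product with \<open>Y\<close> even and thereby all of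
      \<open>E\<close>, \<open>E1\<close>, \<open>E2\<close>, \<open>E3\<close>.\<close>
    then have "even E"
      using par m4 False by auto
    moreover from this have "even Y"
      using par by (simp add: Y_def)
    ultimately obtain k l where "E = 2 * k" "Y = 2 * l"
      by (elim evenE)
    with 1(1) y show ?thesis by simp
  qed
qed

lemma primitive_add_omega:
  assumes "pure_sqfree \<nu> m"
  shows "primitive_quat (of_int b + omega \<nu>)"
  unfolding primitive_quat_def
proof (intro conjI notI)
  show "of_int b + omega \<nu> \<in> hurwitz"
    using assms omega_hurwitz by simp
  assume "\<exists>n::int. \<exists>q0\<in>hurwitz. n > 1 \<and> of_int b + omega \<nu> = of_int n * q0"
  then obtain n :: int where "n > 1" "ldvd (of_int n) (of_int b + of_int 1 * omega \<nu>)"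
    by (auto simp: ldvd_def)
  then show False
    using qord_ldvd_of_int [OF assms, of n b 1] by simp
qed

section \<open>From conjugation to divisors of \<open>b + omega\<close>\<close>

text \<open>Up to the factor \<open>n\<close>, \<open>qcnj \<rho>\<close> is the inverse of \<rho>,
  so it satisfies the relation with \<open>x\<close> and \<open>x'\<close> exchanged.\<close>

lemma conjugate_commute:
  assumes "\<rho> * x = x' * \<rho>" "\<rho> \<noteq> 0" "qnorm \<rho> = of_int n"
  shows "x * qcnj \<rho> = qcnj \<rho> * x'"
proof -
  have "n \<noteq> 0"
    using assms(2,3) by (metis of_int_0 qnorm_eq_0)
  have "of_int n * (x * qcnj \<rho>) = qcnj \<rho> * (\<rho> * x) * qcnj \<rho>"
    using qcnj_mult(2) [OF assms(3)] by (simp add: mult.assoc [symmetric])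
  also have "\<dots> = (qcnj \<rho> * x') * (\<rho> * qcnj \<rho>)"
    by (simp add: assms(1) mult.assoc)
  also have "\<dots> = of_int n * (qcnj \<rho> * x')"
    by (simp only: qcnj_mult(1) [OF assms(3)] of_int_quat_commute)
  finally show ?thesis
    using \<open>n \<noteq> 0\<close> by (simp only: of_int_mult_cancel_quat) simp
qed

text \<open>It suffices that \<open>n\<close> divides
  \<open>(b + omega \<nu>) * qcnj \<rho>\<close>, as multiplication by \<rho> on the right then
  cancels \<open>n\<close>. The integer \<open>b\<close> is first found modulo the odd part
  \<open>n'\<close> and then adjusted modulo 2.\<close>

lemma ex_rdvd_add_omega:
  assumes \<nu>: "pure_sqfree \<nu> m" and \<rho>: "primitive_quat \<rho>" and \<nu>': "\<nu>' \<in> hurwitz"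
    and comm: "\<rho> * \<nu> = \<nu>' * \<rho>"
    and odd_norm: "m mod 8 = 3 \<Longrightarrow> \<exists>n::nat. qnorm \<rho> = of_nat n \<and> odd n"
  shows "\<exists>b. rdvd \<rho> (of_int b + omega \<nu>)"
proof -
  have \<rho>H: "\<rho> \<in> hurwitz" and \<rho>0: "\<rho> \<noteq> 0"
    using \<rho> primitive_quat_nonzero by (auto simp: primitive_quat_def)
  obtain n where n: "qnorm \<rho> = of_int n"
    using hurwitz_qnorm [OF \<rho>H] by metis
  then have n0: "n \<noteq> 0"
    using \<rho>0 by (metis of_int_0 qnorm_eq_0)
  have pure': "pure_sqfree \<nu>' m"
    using pure_sqfree_conjugate \<nu> \<nu>' comm \<rho>0 by blast
  have m8: "m mod 8 = 3 \<longleftrightarrow> m mod 4 = 3"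
    using pure_sqfree_coords [OF \<nu>] by metis
  \<comment> \<open>Since \<open>4\<close> does not divide \<open>n\<close>, the cofactor
    \<open>k\<close> of the odd part is at most \<open>2\<close>; the hypothesis on odd norms
    excludes \<open>2\<close> if \<open>m mod 4 = 3\<close>.\<close>
  obtain k n' where kn: "n = n' * k" "odd n'" "k = 1 \<or> k = 2 \<and> m mod 4 \<noteq> 3"
  proof (cases "even n")
    case True
    then obtain l where l: "n = 2 * l" by (rule evenE)
    then have "odd l"
      using primitive_not_4_dvd_norm [OF \<rho> n] by auto
    moreover have "m mod 4 \<noteq> 3"
    proof
      assume "m mod 4 = 3"
      then obtain j :: nat where "qnorm \<rho> = of_nat j" "odd j"
        using odd_norm m8 by blast
      then have "n = int j"
        using n by (metis of_int_eq_iff of_int_of_nat_eq)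
      with True \<open>odd j\<close> show False by simp
    qed
    ultimately show thesis
      using that [of l 2] l by simp
  qed (use that [of n 1] in simp)
  obtain x v where x: "x \<in> hurwitz" and tr_x: "2 * qRe (x * qcnj \<rho>) = of_int (1 - n' * v)"
    using primitive_trace_eq_1_mod_odd [OF \<rho> kn(2)] by blast
  define h1 where "h1 = of_int v * qcnj \<rho> + of_int k * qcnj x"
  \<comment> \<open>As the trace is \<open>1\<close> modulo \<open>n'\<close>, the sandwich around
    \<open>x\<close> reproduces \<open>qcnj \<rho>\<close> modulo \<open>n'\<close>.\<close>
  have cnj_eq: "qcnj \<rho> = qcnj \<rho> * x * qcnj \<rho> + of_int n' * h1"
    unfolding qcnj_sandwich [OF tr_x n] h1_def kn(1)
    by (simp add: left_diff_distrib distrib_left mult.assoc)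
  define y where "y = omega \<nu>' * x"
  have yH: "y \<in> hurwitz"
    using x omega_hurwitz [OF pure'] by (simp add: y_def)
  then obtain t where t: "2 * qRe (y * qcnj \<rho>) = of_int t"
    using hurwitz_trace [of "y * qcnj \<rho>"] \<rho>H by auto
  have comm': "omega \<nu> * qcnj \<rho> = qcnj \<rho> * omega \<nu>'"
    using conjugate_commute [OF omega_conjugate [OF \<nu> pure' comm] \<rho>0 n] .
  define h where "h = omega \<nu> * h1 - of_int k * qcnj y"
  have h: "h \<in> hurwitz"
    using omega_hurwitz [OF \<nu>] \<rho>H yH x by (simp add: h_def h1_def)
  have "omega \<nu> * qcnj \<rho> = omega \<nu> * (qcnj \<rho> * x * qcnj \<rho>) + omega \<nu> * (of_int n' * h1)"
    by (subst cnj_eq) (simp only: distrib_left)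
  \<comment> \<open>Moving \<open>omega\<close> past \<open>qcnj \<rho>\<close> produces another
    sandwich, now around \<open>y\<close>; its trace \<open>t\<close> is the scalar by which
    \<open>omega \<nu>\<close> acts on \<open>qcnj \<rho>\<close> modulo \<open>n'\<close>.\<close>
  also have "omega \<nu> * (qcnj \<rho> * x * qcnj \<rho>) = qcnj \<rho> * y * qcnj \<rho>"
    unfolding mult.assoc [symmetric] comm' by (simp only: y_def mult.assoc)
  also have "\<dots> = of_int t * qcnj \<rho> - of_int n * qcnj y"
    by (rule qcnj_sandwich [OF t n])
  finally have "omega \<nu> * qcnj \<rho> = of_int t * qcnj \<rho> + of_int n' * h"
    unfolding of_int_quat_left_commute [of "omega \<nu>"] h_def kn(1)
    by (simp add: right_diff_distrib mult.assoc)
  then have scal: "(of_int (- t) + omega \<nu>) * qcnj \<rho> = of_int n' * h"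
    by (simp add: left_diff_distrib)
  have "\<exists>b. ldvd (of_int n) ((of_int b + omega \<nu>) * qcnj \<rho>)"
    using kn(3)
  proof
    assume "k = 1"
    with scal h kn(1) show ?thesis
      unfolding ldvd_def by (metis mult.right_neutral)
  next
    assume k: "k = 2 \<and> m mod 4 \<noteq> 3"
    \<comment> \<open>Adding the odd number \<open>n'\<close> to \<open>- t\<close> changes its
      parity but not its class modulo \<open>n'\<close>. The parity is chosen so that
      \<open>b\<^sup>2 + m\<close>, the norm of \<open>b + omega \<nu>\<close>, is even.\<close>
    define \<epsilon> :: int where "\<epsilon> = (if even (int m - t) then 0 else 1)"
    define b where "b = - t + n' * \<epsilon>"
    have "(of_int b + omega \<nu>) * qcnj \<rho> = of_int n' * (of_int \<epsilon> * qcnj \<rho>) + (of_int (- t) + omega \<nu>) * qcnj \<rho>"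
      by (simp add: b_def distrib_right left_diff_distrib mult.assoc)
    then have 1: "(of_int b + omega \<nu>) * qcnj \<rho> = of_int n' * (of_int \<epsilon> * qcnj \<rho> + h)"
      unfolding scal by (simp only: distrib_left)
    have "even (b + int m)"
      using kn(2) by (auto simp: b_def \<epsilon>_def)
    then have "even (b\<^sup>2 + int m)"
      by simp
    then obtain l where l: "b\<^sup>2 + int m = 2 * l" by (rule evenE)
    have om: "omega \<nu> = \<nu>"
      using k \<nu> omega_eq by (simp add: pure_sqfree_def)
    have "qnorm (of_int b + omega \<nu>) = of_int (b\<^sup>2 + int m)"
      using \<nu> by (auto simp: om pure_sqfree_def qnorm_def)
    moreover have "qnorm (qcnj \<rho>) = of_int (2 * n')"
      using n kn(1) k by simp
    ultimately have "ldvd (of_int 2) ((of_int b + omega \<nu>) * qcnj \<rho>)"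
      using \<rho>H omega_hurwitz [OF \<nu>] unfolding l by (intro ldvd_2_mult_even_norm) simp_all
    then have "ldvd (of_int 2) (of_int \<epsilon> * qcnj \<rho> + h)"
      unfolding 1 using kn(2) h \<rho>H by (elim ldvd_of_int_coprime) simp_all
    then obtain h2 where "h2 \<in> hurwitz" "of_int \<epsilon> * qcnj \<rho> + h = of_int 2 * h2"
      unfolding ldvd_def by blast
    then have "(of_int b + omega \<nu>) * qcnj \<rho> = of_int n * h2"
      unfolding 1 kn(1) using k by (simp add: mult.assoc)
    with \<open>h2 \<in> hurwitz\<close> show ?thesis
      unfolding ldvd_def by blast
  qed
  then obtain b h' where h': "h' \<in> hurwitz" "(of_int b + omega \<nu>) * qcnj \<rho> = of_int n * h'"
    unfolding ldvd_def by blast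
  have "of_int n * (of_int b + omega \<nu>) = (of_int b + omega \<nu>) * (qcnj \<rho> * \<rho>)"
    by (simp only: qcnj_mult(2) [OF n] of_int_quat_commute)
  also have "\<dots> = of_int n * (h' * \<rho>)"
    by (simp only: mult.assoc [symmetric] h'(2))
  finally have "of_int b + omega \<nu> = h' * \<rho>"
    using n0 by (simp only: of_int_mult_cancel_quat) simp
  with h'(1) show ?thesis
    unfolding rdvd_def by blast
qed

lemma ldvd_uminus: "ldvd d x \<Longrightarrow> ldvd d (- x)"
  unfolding ldvd_def by (metis hurwitz_minus mult_minus_right)

text \<open>The relation for \<open>qcnj \<rho>\<close> runs from \<nu>' back to \<nu>, so the
  statement on right divisors applies to it; conjugation then turns right divisors into left
  ones.\<close>

lemma ex_ldvd_add_omega: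
  assumes \<nu>: "pure_sqfree \<nu> m" and \<rho>: "primitive_quat \<rho>" and \<nu>': "\<nu>' \<in> hurwitz"
    and comm: "\<rho> * \<nu> = \<nu>' * \<rho>"
    and odd_norm: "m mod 8 = 3 \<Longrightarrow> \<exists>n::nat. qnorm \<rho> = of_nat n \<and> odd n"
  shows "\<exists>b. ldvd \<rho> (of_int b + omega \<nu>')"
proof -
  have \<rho>H: "\<rho> \<in> hurwitz" and \<rho>0: "\<rho> \<noteq> 0"
    using \<rho> primitive_quat_nonzero by (auto simp: primitive_quat_def)
  obtain n where n: "qnorm \<rho> = of_int n"
    using hurwitz_qnorm [OF \<rho>H] by metis
  have pure': "pure_sqfree \<nu>' m"
    using pure_sqfree_conjugate \<nu> \<nu>' comm \<rho>0 by blast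
  have "qcnj \<rho> * \<nu>' = \<nu> * qcnj \<rho>"
    using conjugate_commute [OF comm \<rho>0 n] by simp
  then obtain b where "rdvd (qcnj \<rho>) (of_int b + omega \<nu>')"
    using ex_rdvd_add_omega [OF pure', of "qcnj \<rho>" \<nu>] \<rho> \<nu> odd_norm
    by (auto simp: primitive_qcnj pure_sqfree_def)
  then have "ldvd \<rho> (qcnj (of_int b + omega \<nu>'))"
    using rdvd_qcnj [of \<rho> "qcnj (of_int b + omega \<nu>')"] by simp
  then have "ldvd \<rho> (- qcnj (of_int b + omega \<nu>'))"
    by (rule ldvd_uminus)
  \<comment> \<open>The conjugate of \<open>omega \<nu>'\<close> is its trace minus itself, so
    negation restores the form integer plus \<open>omega \<nu>'\<close>.\<close>
  also have "- qcnj (of_int b + omega \<nu>') = of_int (- b - (int (qord_r \<nu>') - 1)) + omega \<nu>'"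
    using qcnj_eq_trace [OF omega_trace [OF pure']] by simp
  finally show ?thesis
    by blast
qed

section \<open>Greatest common divisors and ideals of the order\<close>

text \<open>A common divisor \<open>e\<close> inherits primitivity from \<open>x\<close>, and a
  primitive divisor of the integer \<open>n\<close> has norm dividing \<open>n\<close>, which is the
  norm of \<open>d\<close>.\<close>

lemma is_gcd_r_norm:
  assumes "primitive_quat x" "primitive_quat d" "qnorm d = of_int n" "rdvd d x"
  shows "is_gcd_r (of_int n) x d"
  unfolding is_gcd_r_def
proof (intro conjI ballI impI)
  show d: "d \<in> hurwitz"
    using assms(2) by (simp add: primitive_quat_def)
  show "rdvd d x"
    by fact
  show "rdvd d (of_int n)"
    unfolding rdvd_def using d qcnj_mult(2) [OF assms(3)] by (metis hurwitz_qcnj)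
  fix e assume e: "e \<in> hurwitz" and dvd: "rdvd e (of_int n) \<and> rdvd e x"
  have "primitive_quat e"
    using dvd e primitive_divisor [OF assms(1)] unfolding rdvd_def by blast
  moreover have "ldvd (qcnj e) (of_int n)"
    using dvd ldvd_qcnj [of e "of_int n"] by simp
  moreover obtain k where k: "qnorm e = of_int k"
    using hurwitz_qnorm [OF e] by metis
  ultimately have "k dvd n"
    using primitive_ldvd_int [of "qcnj e" k n] by (simp add: primitive_qcnj)
  moreover have "n > 0"
    using primitive_quat_nonzero [OF assms(2)] qnorm_nonneg [of d] assms(3)
    by (metis less_eq_real_def of_int_0_less_iff qnorm_eq_0)
  ultimately show "qnorm e \<le> qnorm d"
    using k assms(3) by (simp add: zdvd_imp_le)
qed

lemma is_gcd_l_norm: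
  assumes "primitive_quat x" "primitive_quat d" "qnorm d = of_int n" "ldvd d x"
  shows "is_gcd_l (of_int n) x d"
proof -
  have *: "is_gcd_r (of_int n) (qcnj x) (qcnj d)"
    using assms by (intro is_gcd_r_norm) (simp_all add: primitive_qcnj rdvd_qcnj)
  have "rdvd (qcnj e) (of_int n) \<longleftrightarrow> ldvd e (of_int n)" for e
    using rdvd_qcnj [of e "of_int n"] by simp
  then show ?thesis
    using * unfolding is_gcd_r_def is_gcd_l_def
    by (metis hurwitz_qcnj qnorm_simps(1) rdvd_qcnj)
qed

text \<open>The square of \<open>u\<close> is reduced by its characteristic equation
  \<open>u * u = t * u - n\<close>.\<close>

lemma quadratic_mult:
  assumes "2 * qRe u = of_int t" "qnorm u = of_int n"
  shows "(of_int x + of_int y * u) * (of_int p + of_int q * u) =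
    of_int (x * p - y * q * n) + of_int (x * q + y * p + y * q * t) * u"
proof -
  have n: "real_of_int n = qRe u * qRe u + qI u * qI u + qJ u * qJ u + qK u * qK u"
    using assms(2) by (simp add: qnorm_def power2_eq_square)
  show ?thesis
    by (simp add: quat_eq_iff assms(1) [symmetric] n algebra_simps)
qed

lemma qord_eq_shift:
  "qord \<nu> = {of_int p + of_int q * (of_int b + omega \<nu>) | p q :: int. True}" (is "_ = ?R")
proof (intro Set.set_eqI iffI)
  fix z assume "z \<in> qord \<nu>"
  then obtain x y :: int where "z = of_int x + of_int y * omega \<nu>"
    by (auto simp: qord_def)
  then have "z = of_int (x - y * b) + of_int y * (of_int b + omega \<nu>)"
    by (simp add: distrib_left)
  then show "z \<in> ?R"
    by blast
next
  fix z assume "z \<in> ?R"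
  then obtain p q :: int where "z = of_int p + of_int q * (of_int b + omega \<nu>)"
    by auto
  then have "z = of_int (p + q * b) + of_int q * omega \<nu>"
    by (simp add: distrib_left)
  then show "z \<in> qord \<nu>"
    unfolding qord_def by blast
qed

lemma qord_add: "x \<in> qord \<nu> \<Longrightarrow> y \<in> qord \<nu> \<Longrightarrow> x + y \<in> qord \<nu>"
proof -
  assume "x \<in> qord \<nu>" "y \<in> qord \<nu>"
  then obtain a b c d :: int where "x = of_int a + of_int b * omega \<nu>" "y = of_int c + of_int d * omega \<nu>"
    by (auto simp: qord_def)
  then have "x + y = of_int (a + c) + of_int (b + d) * omega \<nu>"
    by (simp add: distrib_right)
  then show ?thesis
    unfolding qord_def by blast
qed

lemma qord_uminus: "x \<in> qord \<nu> \<Longrightarrow> - x \<in> qord \<nu>"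
proof -
  assume "x \<in> qord \<nu>"
  then obtain a b :: int where "x = of_int a + of_int b * omega \<nu>"
    by (auto simp: qord_def)
  then have "- x = of_int (- a) + of_int (- b) * omega \<nu>"
    by simp
  then show ?thesis
    unfolding qord_def by blast
qed

lemma qord_of_int: "of_int z \<in> qord \<nu>"
  unfolding qord_def by (rule CollectI, intro exI [of _ z] exI [of _ 0]) simp

lemma omega_in_qord: "omega \<nu> \<in> qord \<nu>"
  unfolding qord_def by (rule CollectI, intro exI [of _ 0] exI [of _ 1]) simp

lemma qord_mult:
  assumes "pure_sqfree \<nu> m" "x \<in> qord \<nu>" "y \<in> qord \<nu>"
  shows "x * y \<in> qord \<nu>" "x * y = y * x"
proof -
  obtain a b c d :: int where xy: "x = of_int a + of_int b * omega \<nu>" "y = of_int c + of_int d * omega \<nu>"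
    using assms by (auto simp: qord_def)
  obtain n where n: "qnorm (omega \<nu>) = of_int n"
    using hurwitz_qnorm [OF omega_hurwitz [OF assms(1)]] by metis
  show "x * y \<in> qord \<nu>"
    unfolding xy quadratic_mult [OF omega_trace [OF assms(1)] n] qord_def by blast
  show "x * y = y * x"
    unfolding xy quadratic_mult [OF omega_trace [OF assms(1)] n]
    by (simp only: mult_ac add_ac)
qed

lemma ring_qord:
  assumes "pure_sqfree \<nu> m"
  shows "ring (qord_ring \<nu>)"
proof (rule ringI)
  show "abelian_group (qord_ring \<nu>)"
    using qord_add qord_uminus qord_of_int [of 0 \<nu>]
    by (intro abelian_groupI) (auto simp: qord_ring_def add.assoc add.commute intro!: bexI [of _ "- x" for x])
  show "monoid (qord_ring \<nu>)"
    using qord_mult(1) [OF assms] qord_of_int [of 1 \<nu>]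
    by (intro monoidI) (auto simp: qord_ring_def mult.assoc)
qed (simp_all add: qord_ring_def distrib_left distrib_right)

lemma basis_span_subset_qord: "basis_span \<nu> c a b \<subseteq> qord \<nu>"
proof
  fix z assume "z \<in> basis_span \<nu> c a b"
  then obtain x y :: int where "z = of_int c * (of_int x * of_int a + of_int y * (of_int b + omega \<nu>))"
    by (auto simp: basis_span_def)
  then have "z = of_int (c * x * a) + of_int (c * y) * (of_int b + omega \<nu>)"
    by (simp add: distrib_left mult.assoc)
  then show "z \<in> qord \<nu>"
    unfolding qord_eq_shift [of \<nu> b] by blast
qed

text \<open>With \<open>u = b + omega \<nu>\<close> and trace \<open>t\<close>, the characteristic
  equation reads \<open>u * u = t * u - a * k\<close>. The constant term is a multiple of
  \<open>a\<close>, which keeps products with elements of the order inside the span.\<close>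

lemma ideal_basis_span:
  assumes \<nu>: "pure_sqfree \<nu> m" and norm: "qnorm (of_int b + omega \<nu>) = of_int (a * k)"
  shows "ideal (basis_span \<nu> c a b) (qord_ring \<nu>)"
proof (rule idealI)
  let ?R = "qord_ring \<nu>" and ?I = "basis_span \<nu> c a b"
  show ring: "ring ?R"
    by (rule ring_qord [OF \<nu>])
  interpret ring ?R by fact
  show "subgroup ?I (add_monoid ?R)"
  proof (rule subgroup.intro)
    show "?I \<subseteq> carrier (add_monoid ?R)"
      using basis_span_subset_qord by (simp add: qord_ring_def)
    have "0 = of_int c * (of_int 0 * of_int a + of_int 0 * (of_int b + omega \<nu>))"
      by simp
    then have "0 \<in> ?I"
      unfolding basis_span_def by blast
    then show "\<one>\<^bsub>add_monoid ?R\<^esub> \<in> ?I"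
      by (simp add: qord_ring_def)
  next
    fix z w assume "z \<in> ?I" "w \<in> ?I"
    then obtain x y x' y' :: int where
      "z = of_int c * (of_int x * of_int a + of_int y * (of_int b + omega \<nu>))"
      "w = of_int c * (of_int x' * of_int a + of_int y' * (of_int b + omega \<nu>))"
      by (auto simp: basis_span_def)
    then have "z + w = of_int c * (of_int (x + x') * of_int a + of_int (y + y') * (of_int b + omega \<nu>))"
      by (simp add: distrib_left distrib_right add_ac)
    then have "z + w \<in> ?I"
      unfolding basis_span_def by blast
    then show "z \<otimes>\<^bsub>add_monoid ?R\<^esub> w \<in> ?I"
      by (simp add: qord_ring_def)
  next
    fix z assume z: "z \<in> ?I"
    then obtain x y :: int where
      "z = of_int c * (of_int x * of_int a + of_int y * (of_int b + omega \<nu>))"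
      by (auto simp: basis_span_def)
    then have "- z = of_int c * (of_int (- x) * of_int a + of_int (- y) * (of_int b + omega \<nu>))"
      by (simp add: distrib_left right_diff_distrib)
    then have "- z \<in> ?I"
      unfolding basis_span_def by blast
    moreover have "z \<in> qord \<nu>"
      using z basis_span_subset_qord by blast
    then have "\<ominus>\<^bsub>?R\<^esub> z = - z"
      using qord_uminus by (intro minus_equality) (auto simp: qord_ring_def)
    ultimately show "inv\<^bsub>add_monoid ?R\<^esub> z \<in> ?I"
      by (simp add: a_inv_def)
  qed
  fix z w assume z: "z \<in> ?I" and w: "w \<in> carrier ?R"
  obtain x y :: int where
    z_eq: "z = of_int c * (of_int x * of_int a + of_int y * (of_int b + omega \<nu>))"
    using z by (auto simp: basis_span_def)
  obtain p q :: int where w_eq: "w = of_int p + of_int q * (of_int b + omega \<nu>)"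
    using w qord_eq_shift [of \<nu> b] by (auto simp: qord_ring_def)
  define t where "t = 2 * b + (int (qord_r \<nu>) - 1)"
  have t: "2 * qRe (of_int b + omega \<nu>) = of_int t"
    using omega_trace [OF \<nu>] by (simp add: t_def)
  have "z * w = of_int c * ((of_int (x * a) + of_int y * (of_int b + omega \<nu>)) * w)"
    by (simp add: z_eq mult.assoc)
  also have "\<dots> = of_int c * (of_int (x * p - y * q * k) * of_int a +
      of_int (x * a * q + y * p + y * q * t) * (of_int b + omega \<nu>))"
    unfolding w_eq quadratic_mult [OF t norm] of_int_mult [symmetric]
    by (simp only: left_diff_distrib right_diff_distrib mult_ac)
  finally have "z * w \<in> ?I"
    unfolding basis_span_def by blast
  moreover have "w * z = z * w"
    using w subsetD [OF basis_span_subset_qord z] qord_mult(2) [OF \<nu>] by (simp add: qord_ring_def)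
  ultimately show "w \<otimes>\<^bsub>?R\<^esub> z \<in> ?I" "z \<otimes>\<^bsub>?R\<^esub> w \<in> ?I"
    by (simp_all add: qord_ring_def)
qed

text \<open>A factorization \<open>b + omega \<nu> = q * d\<close> shows that \<open>n\<close>
  divides the norm of \<open>b + omega \<nu>\<close>, which is the criterion for the span of
  \<open>n\<close> and \<open>b + omega \<nu>\<close> to be an ideal.\<close>

lemma right_pseudo_generator_basis_span:
  assumes "pure_sqfree \<nu> m" "primitive_quat d" "qnorm d = of_int n" "rdvd d (of_int b + omega \<nu>)" "c > 0"
  shows "right_pseudo_generator \<nu> (basis_span \<nu> c n b) (of_int c * d)"
proof -
  obtain q where q: "q \<in> hurwitz" "of_int b + omega \<nu> = q * d"
    using assms(4) by (auto simp: rdvd_def)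
  obtain k where "qnorm q = of_int k"
    using hurwitz_qnorm [OF q(1)] by metis
  then have "qnorm (of_int b + omega \<nu>) = of_int (n * k)"
    using q assms(3) by simp
  moreover have "n > 0"
    using primitive_quat_nonzero [OF assms(2)] qnorm_nonneg [of d] assms(3)
    by (metis less_eq_real_def of_int_0_less_iff qnorm_eq_0)
  ultimately show ?thesis
    unfolding right_pseudo_generator_def
    using ideal_basis_span [OF assms(1)] is_gcd_r_norm [OF primitive_add_omega [OF assms(1)] assms(2,3,4)] assms(5)
    by blast
qed

lemma left_pseudo_generator_basis_span:
  assumes "pure_sqfree \<nu> m" "primitive_quat d" "qnorm d = of_int n" "ldvd d (of_int b + omega \<nu>)" "c > 0"
  shows "left_pseudo_generator \<nu> (basis_span \<nu> c n b) (of_int c * d)"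
proof -
  obtain q where q: "q \<in> hurwitz" "of_int b + omega \<nu> = d * q"
    using assms(4) by (auto simp: ldvd_def)
  obtain k where "qnorm q = of_int k"
    using hurwitz_qnorm [OF q(1)] by metis
  then have "qnorm (of_int b + omega \<nu>) = of_int (n * k)"
    using q assms(3) by simp
  moreover have "n > 0"
    using primitive_quat_nonzero [OF assms(2)] qnorm_nonneg [of d] assms(3)
    by (metis less_eq_real_def of_int_0_less_iff qnorm_eq_0)
  ultimately show ?thesis
    unfolding left_pseudo_generator_def
    using ideal_basis_span [OF assms(1)] is_gcd_l_norm [OF primitive_add_omega [OF assms(1)] assms(2,3,4)] assms(5)
    by blast
qed

section \<open>Euclidean division and principal left ideals\<close>

text \<open>Rounding each coordinate leaves an error of norm at most \<open>4 * (1 / 4)\<close>.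
  Equality means that all coordinates are half-odd, and then \<open>q\<close> is itself a Hurwitz
  quaternion.\<close>

lemma hurwitz_approx:
  obtains h where "h \<in> hurwitz" "qnorm (q - h) < 1"
proof -
  define a b c d :: int where "a = round (qRe q)" and "b = round (qI q)" and "c = round (qJ q)" and "d = round (qK q)"
  define h where "h = Quat (of_int a) (of_int b) (of_int c) (of_int d)"
  have h: "h \<in> hurwitz"
    by (rule hurwitzI [of _ "2 * a" "b - a" "c - a" "d - a"]) (simp_all add: h_def)
  have le: "\<bar>x - of_int (round x)\<bar> \<le> 1 / 2" for x :: real
    using of_int_round_abs_le [of x] by (simp add: abs_minus_commute)
  have sq: "(x - of_int (round x))\<^sup>2 \<le> 1 / 4" for x :: real
    using power_mono [OF le [of x] abs_ge_zero, of 2] by (simp add: power2_eq_square)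
  show thesis
  proof (cases "qnorm (q - h) < 1")
    case True
    with h that show thesis by blast
  next
    case False
    then have eq: "(qRe q - of_int a)\<^sup>2 = 1 / 4" "(qI q - of_int b)\<^sup>2 = 1 / 4"
      "(qJ q - of_int c)\<^sup>2 = 1 / 4" "(qK q - of_int d)\<^sup>2 = 1 / 4"
      using sq [of "qRe q"] sq [of "qI q"] sq [of "qJ q"] sq [of "qK q"]
      unfolding qnorm_def h_def a_def b_def c_def d_def by simp_all
    have half: "\<exists>k::int. x = of_int (2 * k + 1) / 2" if "(x - of_int z)\<^sup>2 = 1 / 4" for x :: real and z :: int
    proof -
      have "(x - of_int z)\<^sup>2 = (1 / 2)\<^sup>2"
        using that by (simp add: power2_eq_square)
      then consider "x - of_int z = 1 / 2" | "x - of_int z = - (1 / 2)"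
        by (auto simp: power2_eq_iff)
      then show ?thesis
      proof cases
        case 1
        then show ?thesis by (intro exI [of _ z]) (simp add: field_simps)
      next
        case 2
        then show ?thesis by (intro exI [of _ "z - 1"]) (simp add: field_simps)
      qed
    qed
    obtain k1 k2 k3 k4 where k: "qRe q = of_int (2 * k1 + 1) / 2" "qI q = of_int (2 * k2 + 1) / 2"
        "qJ q = of_int (2 * k3 + 1) / 2" "qK q = of_int (2 * k4 + 1) / 2"
      using half [OF eq(1)] half [OF eq(2)] half [OF eq(3)] half [OF eq(4)] by blast
    have "q \<in> hurwitz"
      by (rule hurwitzI [of _ "2 * k1 + 1" "k2 - k1" "k3 - k1" "k4 - k1"]) (simp_all add: k field_simps)
    then show thesis
      using that [of q] by simp
  qed
qed

lemma hurwitz_left_ideal_principal: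
  assumes "S \<subseteq> hurwitz" "z \<in> S" "z \<noteq> 0"
    and diff: "\<And>x y. x \<in> S \<Longrightarrow> y \<in> S \<Longrightarrow> x - y \<in> S"
    and mult: "\<And>h x. h \<in> hurwitz \<Longrightarrow> x \<in> S \<Longrightarrow> h * x \<in> S"
  obtains \<delta> where "\<delta> \<in> S" "\<delta> \<noteq> 0" "\<And>x. x \<in> S \<Longrightarrow> rdvd \<delta> x"
proof -
  \<comment> \<open>Norms on \<open>S\<close> are integers, so the floor loses nothing and only
    provides a well-founded measure.\<close>
  obtain \<delta> where \<delta>: "\<delta> \<in> S" "\<delta> \<noteq> 0"
    and min: "\<And>y. y \<in> S \<and> y \<noteq> 0 \<Longrightarrow> nat \<lfloor>qnorm \<delta>\<rfloor> \<le> nat \<lfloor>qnorm y\<rfloor>"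
    using ex_has_least_nat [of "\<lambda>y. y \<in> S \<and> y \<noteq> 0" z "\<lambda>y. nat \<lfloor>qnorm y\<rfloor>"] assms(2,3) by blast
  have "rdvd \<delta> x" if "x \<in> S" for x
  proof -
    obtain h where h: "h \<in> hurwitz" "qnorm (x * inverse \<delta> - h) < 1"
      by (rule hurwitz_approx)
    define r where "r = x - h * \<delta>"
    have r: "r \<in> S"
      using diff mult \<delta> h that by (simp add: r_def)
    have "r = (x * inverse \<delta> - h) * \<delta>"
      using \<delta> by (simp add: r_def left_diff_distrib mult.assoc)
    moreover have "qnorm \<delta> > 0"
      using \<delta> qnorm_nonneg [of \<delta>] by (metis less_eq_real_def qnorm_eq_0)
    ultimately have less: "qnorm r < qnorm \<delta>"
      using h by simp
    obtain k l where kl: "qnorm r = of_int k" "0 \<le> k" "qnorm \<delta> = of_int l"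
      using hurwitz_qnorm [of r] hurwitz_qnorm [of \<delta>] subsetD [OF assms(1) r] subsetD [OF assms(1) \<delta>(1)]
      by metis
    have "r = 0"
    proof (rule ccontr)
      assume "r \<noteq> 0"
      then have "nat l \<le> nat k"
        using min [of r] r kl by simp
      with less kl show False by simp
    qed
    then have "x = h * \<delta>"
      by (simp add: r_def)
    with h show ?thesis
      unfolding rdvd_def by blast
  qed
  with \<delta> that show thesis by blast
qed

text \<open>The generator \<delta> of the left ideal spanned by \<open>x\<close> and
  \<open>y\<close> is a common divisor and has the form \<open>q * d\<close>. Maximality of the norm
  of \<open>d\<close> makes \<open>q\<close> a unit with inverse \<open>qcnj q\<close>.\<close>

lemma is_gcd_r_bezout:
  assumes gcd: "is_gcd_r x y d" and xy: "x \<in> hurwitz" "y \<in> hurwitz" "x \<noteq> 0"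
  obtains \<alpha> \<beta> where "\<alpha> \<in> hurwitz" "\<beta> \<in> hurwitz" "d = \<alpha> * x + \<beta> * y"
proof -
  define S where "S = {\<alpha> * x + \<beta> * y | \<alpha> \<beta>. \<alpha> \<in> hurwitz \<and> \<beta> \<in> hurwitz}"
  have S: "\<alpha> * x + \<beta> * y \<in> S" if "\<alpha> \<in> hurwitz" "\<beta> \<in> hurwitz" for \<alpha> \<beta>
    unfolding S_def using that by blast
  have x: "x \<in> S" and y: "y \<in> S"
    using S [of 1 0] S [of 0 1] by simp_all
  have "S \<subseteq> hurwitz"
    using xy by (auto simp: S_def)
  moreover have "s - t \<in> S" if "s \<in> S" "t \<in> S" for s t
  proof -
    obtain \<alpha> \<beta> \<alpha>' \<beta>' where st: "s = \<alpha> * x + \<beta> * y" "t = \<alpha>' * x + \<beta>' * y"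
      and "\<alpha> \<in> hurwitz" "\<beta> \<in> hurwitz" "\<alpha>' \<in> hurwitz" "\<beta>' \<in> hurwitz"
      using \<open>s \<in> S\<close> \<open>t \<in> S\<close> by (auto simp: S_def)
    then have "(\<alpha> - \<alpha>') * x + (\<beta> - \<beta>') * y \<in> S"
      by (intro S) simp_all
    then show ?thesis
      by (simp add: st left_diff_distrib add_diff_add)
  qed
  moreover have "h * s \<in> S" if h: "h \<in> hurwitz" and "s \<in> S" for h s
  proof -
    obtain \<alpha> \<beta> where s: "s = \<alpha> * x + \<beta> * y" and "\<alpha> \<in> hurwitz" "\<beta> \<in> hurwitz"
      using \<open>s \<in> S\<close> by (auto simp: S_def)
    then have "(h * \<alpha>) * x + (h * \<beta>) * y \<in> S"
      using h by (intro S) simp_all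
    then show ?thesis
      by (simp add: s distrib_left mult.assoc)
  qed
  ultimately obtain \<delta> where \<delta>: "\<delta> \<in> S" "\<delta> \<noteq> 0" and dvd: "\<And>s. s \<in> S \<Longrightarrow> rdvd \<delta> s"
    using hurwitz_left_ideal_principal [OF _ x xy(3)] by metis
  obtain \<alpha> \<beta> where ab: "\<alpha> \<in> hurwitz" "\<beta> \<in> hurwitz" "\<delta> = \<alpha> * x + \<beta> * y"
    using \<delta>(1) by (auto simp: S_def)
  have d: "d \<in> hurwitz" "rdvd d x" "rdvd d y"
    using gcd by (auto simp: is_gcd_r_def)
  then obtain u v where uv: "u \<in> hurwitz" "x = u * d" "v \<in> hurwitz" "y = v * d"
    by (auto simp: rdvd_def)
  define q where "q = \<alpha> * u + \<beta> * v"
  have q: "q \<in> hurwitz"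
    using ab uv by (simp add: q_def)
  have \<delta>_eq: "\<delta> = q * d"
    unfolding ab(3) q_def distrib_right mult.assoc uv(2,4) [symmetric] ..
  have "\<delta> \<in> hurwitz"
    using \<delta>_eq q d by simp
  then have "qnorm q * qnorm d \<le> qnorm d"
    using gcd dvd [OF x] dvd [OF y] \<delta>_eq unfolding is_gcd_r_def by (metis qnorm_simps(2))
  moreover have "qnorm d > 0"
    using \<delta>_eq \<delta>(2) qnorm_nonneg [of d] by (metis less_eq_real_def mult_zero_right qnorm_eq_0)
  ultimately have "qnorm q \<le> 1"
    by simp
  moreover obtain n where n: "qnorm q = of_int n" "0 \<le> n"
    using hurwitz_qnorm [OF q] by metis
  moreover have "qnorm q \<noteq> 0"
    using \<delta>_eq \<delta>(2) by auto
  ultimately have "n = 1"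
    by simp
  then have "d = qcnj q * \<delta>"
    using qcnj_mult(2) [OF n(1)] by (simp add: \<delta>_eq mult.assoc [symmetric])
  then have "d = (qcnj q * \<alpha>) * x + (qcnj q * \<beta>) * y"
    by (simp add: ab(3) distrib_left mult.assoc)
  then show thesis
    using that [of "qcnj q * \<alpha>" "qcnj q * \<beta>"] q ab by simp
qed

section \<open>From pseudo generators back to conjugation\<close>

text \<open>Four times the norm of \<open>b + omega \<nu>\<close> is
  \<open>(2 * b + 1)\<^sup>2 + m\<close>, which is \<open>4\<close> modulo \<open>8\<close>. So this
  norm is odd, and so is its divisor \<open>qnorm d\<close>.\<close>

lemma odd_norm_rdvd_add_omega:
  assumes \<nu>: "pure_sqfree \<nu> m" and m: "m mod 8 = 3" and d: "d \<in> hurwitz" "rdvd d (of_int b + omega \<nu>)"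
  shows "\<exists>n::nat. qnorm d = of_nat n \<and> odd n"
proof -
  have norm: "qnorm \<nu> = of_nat m" "qRe \<nu> = 0"
    using \<nu> by (simp_all add: pure_sqfree_def)
  have "m mod 4 = 3"
    using m by presburger
  obtain q where q: "q \<in> hurwitz" "of_int b + omega \<nu> = q * d"
    using d(2) by (auto simp: rdvd_def)
  obtain k n where k: "qnorm q = of_int k" and n: "qnorm d = of_int n" "0 \<le> n"
    using hurwitz_qnorm q(1) d(1) by metis
  have "4 * qnorm (of_int b + omega \<nu>) = (2 * of_int b + 1)\<^sup>2 + of_nat m"
    using norm \<open>m mod 4 = 3\<close>
    by (simp add: omega_eq [OF norm(1)] qnorm_def power2_eq_square field_simps)
  then have "real_of_int (4 * (k * n)) = of_int ((2 * b + 1)\<^sup>2 + int m)"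
    by (simp add: q k n)
  then have eq: "4 * (k * n) = (2 * b + 1)\<^sup>2 + int m"
    by (simp only: of_int_eq_iff)
  moreover have "(2 * b + 1)\<^sup>2 mod 8 = 1"
    by (rule odd_square_mod_8) simp
  moreover have "odd j" if "4 * j = x + int m" "x mod 8 = 1" for j x
    using that m by presburger
  ultimately have "odd (k * n)"
    by blast
  then have "odd (nat n)"
    using n(2) by (simp add: even_nat_iff)
  with n show ?thesis
    by (intro exI [of _ "nat n"]) simp
qed

text \<open>Every element of the ideal, divided by \<open>c\<close>, is right divisible by
  \<open>d\<close>. Closure under \<open>omega \<nu>\<close> applied to both basis elements,
  combined with the Bezout form of \<open>d\<close>, puts \<open>d * omega \<nu>\<close> into the
  left ideal generated by \<open>d\<close>.\<close>

lemma right_pseudo_generator_conjugates: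
  assumes \<nu>: "pure_sqfree \<nu> m"
    and I: "ideal (basis_span \<nu> c a b) (qord_ring \<nu>)" "c > 0" "a > 0"
    and gcd: "is_gcd_r (of_int a) (of_int b + omega \<nu>) d"
  shows "\<exists>\<nu>'\<in>hurwitz. d * \<nu> = \<nu>' * d"
proof -
  let ?u = "of_int b + omega \<nu>"
  have uH: "?u \<in> hurwitz"
    using omega_hurwitz [OF \<nu>] by simp
  obtain \<alpha> \<beta> where ab: "\<alpha> \<in> hurwitz" "\<beta> \<in> hurwitz" "d = \<alpha> * of_int a + \<beta> * ?u"
    using is_gcd_r_bezout [OF gcd _ uH] I(3) by auto
  have d: "rdvd d (of_int a)" "rdvd d ?u"
    using gcd by (auto simp: is_gcd_r_def)
  have span: "rdvd d (of_int x * of_int a + of_int y * ?u)" for x y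
  proof -
    obtain p q where pq: "p \<in> hurwitz" "of_int a = p * d" "q \<in> hurwitz" "?u = q * d"
      using d by (auto simp: rdvd_def)
    have "of_int x * of_int a + of_int y * ?u = (of_int x * p + of_int y * q) * d"
      unfolding pq(2,4) by (simp only: distrib_right mult.assoc)
    with pq show ?thesis
      unfolding rdvd_def by (metis hurwitz_add hurwitz_mult hurwitz_of_int)
  qed
  have "rdvd d ((of_int x * of_int a + of_int y * ?u) * omega \<nu>)" for x y
  proof -
    have "of_int c * (of_int x * of_int a + of_int y * ?u) \<in> basis_span \<nu> c a b"
      unfolding basis_span_def by blast
    then have "of_int c * (of_int x * of_int a + of_int y * ?u) * omega \<nu> \<in> basis_span \<nu> c a b"
      using ideal.I_r_closed [OF I(1)] omega_in_qord [of \<nu>] by (simp add: qord_ring_def)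
    then obtain x' y' :: int where "of_int c * ((of_int x * of_int a + of_int y * ?u) * omega \<nu>) =
        of_int c * (of_int x' * of_int a + of_int y' * ?u)"
      by (auto simp: basis_span_def mult.assoc)
    then have "(of_int x * of_int a + of_int y * ?u) * omega \<nu> = of_int x' * of_int a + of_int y' * ?u"
      using I(2) by (simp only: of_int_mult_cancel_quat) simp
    then show ?thesis
      using span by simp
  qed
  from this [of 1 0] this [of 0 1] obtain p q
    where pq: "p \<in> hurwitz" "of_int a * omega \<nu> = p * d" "q \<in> hurwitz" "?u * omega \<nu> = q * d"
    by (auto simp: rdvd_def)
  define \<gamma> where "\<gamma> = \<alpha> * p + \<beta> * q"
  have "d * omega \<nu> = \<alpha> * (of_int a * omega \<nu>) + \<beta> * (?u * omega \<nu>)"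
    by (subst ab(3)) (simp only: distrib_right mult.assoc)
  then have \<gamma>: "d * omega \<nu> = \<gamma> * d"
    unfolding pq \<gamma>_def by (simp only: distrib_right mult.assoc)
  have \<gamma>H: "\<gamma> \<in> hurwitz"
    using ab pq by (simp add: \<gamma>_def)
  \<comment> \<open>Return from \<open>omega \<nu>\<close> to \<nu> by the integer relation
    \<open>\<nu> = r * omega \<nu> - (r - 1)\<close>.\<close>
  define r where "r = int (qord_r \<nu>)"
  have "\<nu> = of_int r * omega \<nu> - of_int (r - 1)"
    using omega_scaled [OF \<nu>] unfolding r_def by (simp only: add_diff_cancel_left')
  then have "d * \<nu> = d * (of_int r * omega \<nu>) - d * of_int (r - 1)"
    by (metis right_diff_distrib)
  also have "\<dots> = of_int r * (d * omega \<nu>) - of_int (r - 1) * d"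
    unfolding of_int_quat_left_commute [of d r] of_int_quat_commute [of d] ..
  also have "\<dots> = (of_int r * \<gamma> - of_int (r - 1)) * d"
    unfolding \<gamma> by (simp only: left_diff_distrib mult.assoc)
  finally show ?thesis
    using \<gamma>H by (intro bexI [of _ "of_int r * \<gamma> - of_int (r - 1)"]) (simp_all del: of_int_diff)
qed

text \<open>Given an element \<open>c * d * \<xi>\<close> of the order, optimal embedding removes
  \<open>c\<close>. Subtracting a multiple of \<open>b + omega \<nu>\<close> from
  \<open>d * \<xi>\<close> leaves an integer left divisible by \<open>d\<close>, hence a multiple of
  \<open>n\<close>. Conversely, both \<open>n = d * qcnj d\<close> and
  \<open>b + omega \<nu>\<close> are left divisible by \<open>d\<close>.\<close>

lemma L_ideal_eq_basis_span:
  assumes \<nu>: "pure_sqfree \<nu> m" and d: "primitive_quat d" "qnorm d = of_int n"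
    and dvd: "ldvd d (of_int b + omega \<nu>)" and c: "c > 0"
  shows "L_ideal \<nu> (of_int c * d) = basis_span \<nu> c n b"
proof (intro Set.set_eqI iffI)
  have dH: "d \<in> hurwitz"
    using d(1) by (simp add: primitive_quat_def)
  obtain \<eta> where \<eta>: "\<eta> \<in> hurwitz" "of_int b + omega \<nu> = d * \<eta>"
    using dvd by (auto simp: ldvd_def)
  fix z
  {
    assume "z \<in> L_ideal \<nu> (of_int c * d)"
    then obtain \<xi> where \<xi>: "\<xi> \<in> hurwitz" "z = of_int c * (d * \<xi>)" and "z \<in> qord \<nu>"
      by (auto simp: L_ideal_def mult.assoc)
    then obtain x y :: int where z: "z = of_int x + of_int y * omega \<nu>"
      by (auto simp: qord_def)
    have "ldvd (of_int c) z"
      unfolding ldvd_def using \<xi> dH by (intro bexI [of _ "d * \<xi>"]) simp_all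
    then have "c dvd x \<and> c dvd y"
      using qord_ldvd_of_int [OF \<nu> c] z by simp
    then obtain x' y' where xy: "x = c * x'" "y = c * y'"
      by (elim conjE dvdE)
    have "of_int c * (d * \<xi>) = of_int c * (of_int x' + of_int y' * omega \<nu>)"
      using \<xi>(2) z by (simp add: xy distrib_left mult.assoc)
    then have eq: "d * \<xi> = of_int x' + of_int y' * omega \<nu>"
      using c by (simp only: of_int_mult_cancel_quat) simp
    have "of_int (x' - y' * b) = d * \<xi> - of_int y' * (of_int b + omega \<nu>)"
      by (simp add: eq distrib_left)
    also have "\<dots> = d * (\<xi> - of_int y' * \<eta>)"
      unfolding \<eta>(2) right_diff_distrib of_int_quat_left_commute [of d y'] ..
    finally have "ldvd d (of_int (x' - y' * b))"
      unfolding ldvd_def using \<xi>(1) \<eta>(1) by (metis hurwitz_diff hurwitz_mult hurwitz_of_int)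
    then have "n dvd x' - y' * b"
      by (rule primitive_ldvd_int [OF d])
    then obtain k where "x' - y' * b = n * k" ..
    then have "x' = k * n + y' * b"
      by (simp add: algebra_simps)
    then have "z = of_int c * (of_int k * of_int n + of_int y' * (of_int b + omega \<nu>))"
      unfolding \<xi>(2) eq by (simp add: distrib_left)
    then show "z \<in> basis_span \<nu> c n b"
      unfolding basis_span_def by blast
  next
    assume z: "z \<in> basis_span \<nu> c n b"
    then obtain x y :: int where
      z_eq: "z = of_int c * (of_int x * of_int n + of_int y * (of_int b + omega \<nu>))"
      by (auto simp: basis_span_def)
    have "of_int x * of_int n + of_int y * (of_int b + omega \<nu>) = d * (of_int x * qcnj d + of_int y * \<eta>)"
      unfolding \<eta>(2) qcnj_mult(1) [OF d(2), symmetric] distrib_left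
      by (simp only: of_int_quat_left_commute [of d])
    then have "z = of_int c * d * (of_int x * qcnj d + of_int y * \<eta>)"
      by (simp add: z_eq mult.assoc)
    moreover have "of_int x * qcnj d + of_int y * \<eta> \<in> hurwitz"
      using dH \<eta> by simp
    moreover have "z \<in> qord \<nu>"
      using z basis_span_subset_qord by blast
    ultimately show "z \<in> L_ideal \<nu> (of_int c * d)"
      unfolding L_ideal_def by blast
  }
qed

text \<open>In the converse \<rho> has the form \<open>c * d\<close>. The parity claim is made for
  primitive \<rho>, that is for \<open>c = 1\<close>, since an even \<open>c\<close> always makes
  the norm even.\<close>

theorem theorem2:
  fixes \<mu> :: quat and m :: nat
  assumes "\<mu> \<in> hurwitz" and "qRe \<mu> = 0" and "qnorm \<mu> = of_nat m" and "squarefree m"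
  shows
    "(\<forall>\<rho> \<mu>'. primitive_quat \<rho> \<and> \<mu>' \<in> hurwitz \<and> \<rho> * \<mu> = \<mu>' * \<rho> \<and>
        (m mod 8 = 3 \<longrightarrow> (\<exists>n::nat. qnorm \<rho> = of_nat n \<and> odd n)) \<longrightarrow>
        (\<exists>I. right_pseudo_generator \<mu> I \<rho>) \<and> (\<exists>J. left_pseudo_generator \<mu>' J \<rho>)) \<and>
     (\<forall>\<rho> I. right_pseudo_generator \<mu> I \<rho> \<longrightarrow>
        (\<exists>\<mu>'\<in>hurwitz. \<rho> * \<mu> = \<mu>' * \<rho> \<and>
          (m mod 8 = 3 \<and> primitive_quat \<rho> \<longrightarrow> (\<exists>n::nat. qnorm \<rho> = of_nat n \<and> odd n)) \<and>
          left_pseudo_generator \<mu>' (L_ideal \<mu>' \<rho>) \<rho>))"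
proof (intro conjI allI impI)
  have \<mu>: "pure_sqfree \<mu> m"
    using assms by (simp add: pure_sqfree_def)
  {
    fix \<rho> \<mu>'
    assume *: "primitive_quat \<rho> \<and> \<mu>' \<in> hurwitz \<and> \<rho> * \<mu> = \<mu>' * \<rho> \<and>
        (m mod 8 = 3 \<longrightarrow> (\<exists>n::nat. qnorm \<rho> = of_nat n \<and> odd n))"
    then obtain n where n: "qnorm \<rho> = of_int n"
      using hurwitz_qnorm unfolding primitive_quat_def by metis
    have \<mu>': "pure_sqfree \<mu>' m"
      using pure_sqfree_conjugate [OF \<mu>] * primitive_quat_nonzero by blast
    obtain b b' where "rdvd \<rho> (of_int b + omega \<mu>)" "ldvd \<rho> (of_int b' + omega \<mu>')"
      using ex_rdvd_add_omega [OF \<mu>] ex_ldvd_add_omega [OF \<mu>] * by metis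
    then show "\<exists>I. right_pseudo_generator \<mu> I \<rho>" "\<exists>J. left_pseudo_generator \<mu>' J \<rho>"
      using right_pseudo_generator_basis_span [OF \<mu> _ n, of b 1]
        left_pseudo_generator_basis_span [OF \<mu>' _ n, of b' 1] * by auto
  next
    fix \<rho> I
    assume "right_pseudo_generator \<mu> I \<rho>"
    then obtain c a b d where I: "ideal (basis_span \<mu> c a b) (qord_ring \<mu>)" "c > 0" "a > 0"
      and gcd: "is_gcd_r (of_int a) (of_int b + omega \<mu>) d" and \<rho>: "\<rho> = of_int c * d"
      unfolding right_pseudo_generator_def by blast
    obtain \<mu>' where \<mu>'H: "\<mu>' \<in> hurwitz" and comm: "d * \<mu> = \<mu>' * d"
      using right_pseudo_generator_conjugates [OF \<mu> I gcd] by blast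
    have dH: "d \<in> hurwitz" and dvd: "rdvd d (of_int b + omega \<mu>)"
      using gcd by (auto simp: is_gcd_r_def)
    \<comment> \<open>The divisor \<open>d\<close> is primitive even if \<rho> is not, so the
      results of the forward direction apply to \<open>d\<close>, and \<open>c\<close> is carried
      along as a central factor.\<close>
    then have d: "primitive_quat d"
      using primitive_divisor [OF primitive_add_omega [OF \<mu>]] unfolding rdvd_def by blast
    have odd: "\<exists>n::nat. qnorm d = of_nat n \<and> odd n" if "m mod 8 = 3"
      using odd_norm_rdvd_add_omega [OF \<mu> that dH dvd] .
    obtain n where n: "qnorm d = of_int n"
      using hurwitz_qnorm [OF dH] by metis
    have \<mu>': "pure_sqfree \<mu>' m"
      using pure_sqfree_conjugate [OF \<mu> \<mu>'H comm primitive_quat_nonzero [OF d]] .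
    obtain b' where b': "ldvd d (of_int b' + omega \<mu>')"
      using ex_ldvd_add_omega [OF \<mu> d \<mu>'H comm odd] by blast
    show "\<exists>\<mu>'\<in>hurwitz. \<rho> * \<mu> = \<mu>' * \<rho> \<and>
          (m mod 8 = 3 \<and> primitive_quat \<rho> \<longrightarrow> (\<exists>n::nat. qnorm \<rho> = of_nat n \<and> odd n)) \<and>
          left_pseudo_generator \<mu>' (L_ideal \<mu>' \<rho>) \<rho>"
    proof (intro bexI conjI impI)
      show "\<rho> * \<mu> = \<mu>' * \<rho>"
        unfolding \<rho> mult.assoc comm of_int_quat_left_commute [of \<mu>'] ..
      show "\<exists>n::nat. qnorm \<rho> = of_nat n \<and> odd n" if "m mod 8 = 3 \<and> primitive_quat \<rho>"
      proof -
        have "ldvd (of_int c) \<rho>"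
          unfolding ldvd_def using dH \<rho> by blast
        then have "c = 1"
          using primitive_ldvd_of_int that I(2) by blast
        with odd that show ?thesis
          by (simp add: \<rho>)
      qed
      show "left_pseudo_generator \<mu>' (L_ideal \<mu>' \<rho>) \<rho>"
        unfolding \<rho> L_ideal_eq_basis_span [OF \<mu>' d n b' I(2)]
        by (rule left_pseudo_generator_basis_span [OF \<mu>' d n b' I(2)])
    qed (fact \<mu>'H)
  }
qed

end
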